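(* Let $k$ be a field, $n,d\ge1$ integers, $\mathbf u\in\mathbb N^n$, $S=k[x_1,\dots,x_n]$ with graded maximal ideal $\mathfrak m=(x_1,\dots,x_n)$, $\widetilde S=k[x_{ij}\mid 1\le i\le n,\ 1\le j\le d]$, and $F$ a free module of rank $n$ with basis $f_1,\dots,f_n$ over a polynomial ring over $k$. Let $\chi=\{X_i\}_{i\in[n]}$ be a set of rank-preserving isotone maps $X_i:(\Delta^{\mathbb Z}_{\le\mathbf u}(n,d),\le_i)\to\mathcal B_d(\le u_i)$. Then the following are equivalent: 1. The elements of $\mathrm{tab}(\chi)$ span the module $L^1_{d,\le\mathbf u}(F)$. 2. For every $\mathbf c\in\Delta^{\mathbb Z}_{\le\mathbf u}(n,d+1)$, the set $\mathrm{LS}(\mathbf c)$ of linear syzygy edges contains a spanning tree of the complete down-graph $D(\mathbf c)$. 3. The isotone maps $X_1,\dots,X_n$ determine a polarization of $\mathfrak m^d(\le\mathbf u)$.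
   Context: **Restricted powers.** $\mathfrak m^d(\le\mathbf u)$ is the ideal of $S$ generated by the monomials $\mathbf x^{\mathbf a}$ with $\sum_ia_i=d$ and $a_i\le u_i$ for all $i$. **Lattice points and orders.** $\Delta^{\mathbb Z}_{\le\mathbf u}(n,d)$ is the set of $\mathbf a\in\mathbb N^n$ with $\sum a_i=d$ and $a_i\le u_i$ for all $i$. For fixed $i$, the partial order $\ge_i$ on it is: $\mathbf b\ge_i\mathbf a$ iff $b_i\ge a_i$ and $b_j\le a_j$ for all $j\neq i$; $\mathbf a$ has rank $a_i$. $\mathcal B_d$ is the Boolean poset of subsets of $[d]$, and $\mathcal B_d(\le u_i)$ is the subposet of subsets of cardinality at most $u_i$. Isotone means order preserving; rank-preserving means $|X_i(\mathbf a)|=a_i$. $\epsilon_i$ is the $i$th unit vector; $\operatorname{Supp}(\mathbf c)=\{i:c_i>0\}$. **Ideal determined by $\chi$.** For $\mathbf a\in\Delta^{\mathbb Z}_{\le\mathbf u}(n,d)$ let $m(\mathbf a)=\prod_{i=1}^n\prod_{j\in X_i(\mathbf a)}x_{ij}$; let $J\subset\widetilde S$ be the ideal generated by all $m(\mathbf a)$. "The maps determine a polarization of $I$" means that $J$ is a polarization of $I$. **Polarization.** An ideal $\widetilde I\subset\widetilde S$ is a polarization of a monomial ideal $I\subset S$ if $\sigma=\bigcup_{i=1}^n\{x_{i1}-x_{i2},x_{i1}-x_{i3},\dots,x_{i1}-x_{id}\}$ is a regular $\widetilde S/\widetilde I$-sequence and $\widetilde I\otimes\widetilde S/\langle\sigma\rangle\cong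 I$ (i.e. setting $x_{ij}\mapsto x_i$ identifies $\widetilde S/\langle\sigma\rangle$ with $S$ and carries $\widetilde I$ to $I$). **Down-graphs and linear syzygy edges.** For $\mathbf c\in\Delta^{\mathbb Z}_{\le\mathbf u}(n,d+1)$ and distinct $i,j\in\operatorname{Supp}(\mathbf c)$, $(\mathbf c;i,j)$ denotes the edge between $\mathbf c-\epsilon_i$ and $\mathbf c-\epsilon_j$. The complete down-graph $D(\mathbf c)$ is the complete graph on the points $\mathbf c-\epsilon_i$, $i\in\operatorname{Supp}(\mathbf c)$. The edge $(\mathbf c;i,j)$ is a linear syzygy edge if there is a monomial $\mathbf m$ of degree $d-1$ with $m(\mathbf c-\epsilon_i)=x_{jr}\mathbf m$ and $m(\mathbf c-\epsilon_j)=x_{is}\mathbf m$ for some $r,s$; equivalently $X_p(\mathbf c-\epsilon_i)=X_p(\mathbf c-\epsilon_j)$ for all $p\ne i,j$. $\mathrm{LS}(\mathbf c)$ is the set of linear syzygy edges in $D(\mathbf c)$. **Tableaux and the Schur module.** $S_b(F)$ is the $b$th symmetric power, $f^{\mathbf a}=f_1^{a_1}\cdots f_n^{a_n}$, and $\kappa_{a,b}:\bigwedge^aF\otimes S_b(F)\to\bigwedge^{a-1}F\otimes S_{b+1}(F)$ is comultiplication $\bigwedge^aF\to\bigwedge^{a-1}F\otimes F$ followed by multiplication $F\otimes S_b(F)\to S_{b+1}(F)$. $L^a_b(F)=\ker\kappa_{a,b}$, identified with the cokernel of $\kappa_{a+2,b-2}:\bigwedge^{a+2}F\otimes S_{b-2}(F)\to\bigwedge^{a+1}F\otimes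 S_{b-1}(F)$ via $\kappa_{a+1,b-1}$. The multidegree of $f_J\otimes f^\alpha$ (with $f_J=f_{j_1}\wedge\cdots\wedge f_{j_t}$ for $J=\{j_1<\dots<j_t\}$) is $\alpha+\sum_{j\in J}\epsilon_j$; the maps $\kappa$ preserve it, and $L^a_{b,\le\mathbf u}(F)$ is the part of $L^a_b(F)$ in multidegrees $\le\mathbf u$ (coordinatewise). $\mathrm{tab}(\chi)$ is the set of elements $f_i\wedge f_j\otimes f^{\mathbf c-\epsilon_i-\epsilon_j}\in\bigwedge^2F\otimes S_{d-1}(F)$ with $i<j$, for all $\mathbf c\in\Delta^{\mathbb Z}_{\le\mathbf u}(n,d+1)$ and all $(\mathbf c;i,j)\in\mathrm{LS}(\mathbf c)$, viewed in $L^1_d(F)$ via $\kappa_{2,d-1}$. *)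

theory Defs
  imports Complex_Main "HOL-Library.Poly_Mapping" "HOL-Library.FuncSet" "HOL-Library.Cardinality"
begin

text \<open>
  Finite linearly ordered types \<open>'n\<close> and \<open>'d\<close> play the roles of \<open>[n]\<close> and \<open>[d]\<close>, so that
  \<open>n = CARD('n)\<close> and \<open>d = CARD('d)\<close>; both are at least 1 because types are nonempty.
  The polynomial ring over \<open>'k\<close> with variables indexed by \<open>'v\<close> is \<open>('v, 'k) mpoly\<close>: finitely
  supported functions from exponent vectors to coefficients, with the convolution product of
  Poly_Mapping. Thus \<open>S\<close> is \<open>('n, 'k) mpoly\<close> and the ring of the \<open>x\<^sub>i\<^sub>j\<close> is \<open>('n \<times> 'd, 'k) mpoly\<close>.
\<close>

type_synonym ('v, 'k) mpoly = "('v \<Rightarrow>\<^sub>0 nat) \<Rightarrow>\<^sub>0 'k"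

abbreviation eps :: "'v \<Rightarrow> 'v \<Rightarrow>\<^sub>0 nat" where
  "eps i \<equiv> Poly_Mapping.single i 1"

definition total_degree :: "('v::finite \<Rightarrow>\<^sub>0 nat) \<Rightarrow> nat" where
  "total_degree t = (\<Sum>v\<in>UNIV. Poly_Mapping.lookup t v)"

definition monomial :: "('v \<Rightarrow>\<^sub>0 nat) \<Rightarrow> ('v, 'k::comm_ring_1) mpoly" where
  "monomial t = Poly_Mapping.single t 1"

definition var :: "'v \<Rightarrow> ('v, 'k::comm_ring_1) mpoly" where
  "var v = monomial (eps v)"

definition ideal_gen :: "'r::comm_ring_1 set \<Rightarrow> 'r set" where
  "ideal_gen B = module.span (*) B"

lemma module_times: "module ((*) :: 'r::comm_ring_1 \<Rightarrow> 'r \<Rightarrow> 'r)"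
  by unfold_locales (simp_all add: algebra_simps)


section \<open>Lattice points and the Boolean poset\<close>

definition lattice_points :: "('n::finite \<Rightarrow> nat) \<Rightarrow> nat \<Rightarrow> ('n \<Rightarrow>\<^sub>0 nat) set" where
  "lattice_points u e =
     {a. total_degree a = e \<and> (\<forall>i. Poly_Mapping.lookup a i \<le> u i)}"

definition le_at :: "'n \<Rightarrow> ('n \<Rightarrow>\<^sub>0 nat) \<Rightarrow> ('n \<Rightarrow>\<^sub>0 nat) \<Rightarrow> bool" where
  "le_at i a b \<longleftrightarrow> Poly_Mapping.lookup a i \<le> Poly_Mapping.lookup b i \<and>
     (\<forall>j. j \<noteq> i \<longrightarrow> Poly_Mapping.lookup b j \<le> Poly_Mapping.lookup a j)"

definition boolean_poset_le :: "nat \<Rightarrow> 'd::finite set set" where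
  "boolean_poset_le m = {A. card A \<le> m}"

definition restricted_power :: "nat \<Rightarrow> ('n::finite \<Rightarrow> nat) \<Rightarrow> ('n, 'k::comm_ring_1) mpoly set" where
  "restricted_power e u = ideal_gen (monomial ` lattice_points u e)"


section \<open>Polarizations\<close>

text \<open>
  \<open>rs\<close> is a regular sequence on the quotient of the ring by the ideal \<open>I\<close>. Statements about the
  successive quotients of the quotient ring are written as membership in ideals containing \<open>I\<close>.
\<close>

definition regular_sequence_mod :: "'r::comm_ring_1 set \<Rightarrow> 'r list \<Rightarrow> bool" where
  "regular_sequence_mod I rs \<longleftrightarrow>
     (\<forall>m<length rs. \<forall>p. rs ! m * p \<in> ideal_gen (I \<union> set (take m rs))
        \<longrightarrow> p \<in> ideal_gen (I \<union> set (take m rs))) \<and>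
     ideal_gen (I \<union> set rs) \<noteq> UNIV"

text \<open>
  The differences \<open>x\<^sub>i\<^sub>1 - x\<^sub>i\<^sub>j\<close>, \<open>j \<noteq> 1\<close>, in lexicographic order of \<open>(i, j)\<close>;
  \<open>Min UNIV\<close> is the element 1 of \<open>[d]\<close>.
\<close>

definition sigma :: "('n::{finite,linorder} \<times> 'd::{finite,linorder}, 'k::comm_ring_1) mpoly list" where
  "sigma = concat (map (\<lambda>i. map (\<lambda>j. var (i, Min UNIV) - var (i, j))
     (sorted_list_of_set (UNIV - {Min UNIV}))) (sorted_list_of_set UNIV))"

text \<open>
  The \<open>'k\<close>-algebra homomorphism with \<open>x\<^sub>i\<^sub>j \<mapsto> x\<^sub>i\<close>.
\<close>

definition depolarize :: "('n \<times> 'd, 'k::comm_ring_1) mpoly \<Rightarrow> ('n, 'k) mpoly" where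
  "depolarize p = (\<Sum>t\<in>Poly_Mapping.keys p. Poly_Mapping.single 0 (Poly_Mapping.lookup p t) *
     (\<Prod>v\<in>Poly_Mapping.keys t. var (fst v) ^ Poly_Mapping.lookup t v))"

text \<open>
  \<open>depolarize\<close> is surjective with kernel generated by \<open>sigma\<close>, so it identifies the quotient by
  \<open>sigma\<close> with \<open>('n, 'k) mpoly\<close>; the last conjunct says that \<open>I'\<close> is carried to \<open>I\<close>.
\<close>

definition polarization_of ::
    "('n::{finite,linorder} \<times> 'd::{finite,linorder}, 'k::comm_ring_1) mpoly set
      \<Rightarrow> ('n, 'k) mpoly set \<Rightarrow> bool" where
  "polarization_of I' I \<longleftrightarrow> module.subspace (*) I' \<and>
     regular_sequence_mod I' sigma \<and> depolarize ` I' = I"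

text \<open>
  The exponent vector of \<open>m(a) = \<Prod>\<^sub>i \<Prod>\<^sub>j\<^sub>\<in>\<^sub>X\<^sub>i\<^sub>(\<^sub>a\<^sub>) x\<^sub>i\<^sub>j\<close>; monomials are multiplied by adding exponents.
\<close>

definition m_exp :: "('n::finite \<Rightarrow> ('n \<Rightarrow>\<^sub>0 nat) \<Rightarrow> 'd set) \<Rightarrow> ('n \<Rightarrow>\<^sub>0 nat) \<Rightarrow> 'n \<times> 'd \<Rightarrow>\<^sub>0 nat" where
  "m_exp X a = (\<Sum>i\<in>UNIV. \<Sum>j\<in>X i a. eps (i, j))"

definition ideal_of_maps ::
    "('n::finite \<Rightarrow> nat) \<Rightarrow> ('n \<Rightarrow> ('n \<Rightarrow>\<^sub>0 nat) \<Rightarrow> 'd::finite set)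
      \<Rightarrow> ('n \<times> 'd, 'k::comm_ring_1) mpoly set" where
  "ideal_of_maps u X = ideal_gen ((\<lambda>a. monomial (m_exp X a)) ` lattice_points u CARD('d))"


section \<open>Down-graphs and linear syzygy edges\<close>

text \<open>
  Finite simple graphs are given by a vertex set and a set of two-element vertex sets. The
  spanning trees of Graph_Theory are not used: its forests only exclude directed cycles.
\<close>

definition connected_graph :: "'a set \<Rightarrow> 'a set set \<Rightarrow> bool" where
  "connected_graph V E \<longleftrightarrow> V \<noteq> {} \<and>
     (\<forall>x\<in>V. \<forall>y\<in>V. (x, y) \<in> {(a, b). a \<in> V \<and> b \<in> V \<and> {a, b} \<in> E}\<^sup>*)"

definition graph_cycle :: "'a set set \<Rightarrow> 'a list \<Rightarrow> bool" where
  "graph_cycle E vs \<longleftrightarrow> 3 \<le> length vs \<and> distinct vs \<and>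
     (\<forall>m<length vs. {vs ! m, vs ! (Suc m mod length vs)} \<in> E)"

definition tree_graph :: "'a set \<Rightarrow> 'a set set \<Rightarrow> bool" where
  "tree_graph V E \<longleftrightarrow> connected_graph V E \<and> (\<nexists>vs. graph_cycle E vs)"

definition spanning_tree_of :: "'a set \<Rightarrow> 'a set set \<Rightarrow> 'a set set \<Rightarrow> bool" where
  "spanning_tree_of V E T \<longleftrightarrow> T \<subseteq> E \<and> tree_graph V T"

definition down_verts :: "('n \<Rightarrow>\<^sub>0 nat) \<Rightarrow> ('n \<Rightarrow>\<^sub>0 nat) set" where
  "down_verts c = (\<lambda>i. c - eps i) ` Poly_Mapping.keys c"

definition down_edges :: "('n \<Rightarrow>\<^sub>0 nat) \<Rightarrow> ('n \<Rightarrow>\<^sub>0 nat) set set" where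
  "down_edges c = {{c - eps i, c - eps j} | i j.
     i \<in> Poly_Mapping.keys c \<and> j \<in> Poly_Mapping.keys c \<and> i \<noteq> j}"

definition linear_syzygy_edge ::
    "('n::finite \<Rightarrow> ('n \<Rightarrow>\<^sub>0 nat) \<Rightarrow> 'd::finite set) \<Rightarrow> ('n \<Rightarrow>\<^sub>0 nat) \<Rightarrow> 'n \<Rightarrow> 'n \<Rightarrow> bool" where
  "linear_syzygy_edge X c i j \<longleftrightarrow>
     i \<in> Poly_Mapping.keys c \<and> j \<in> Poly_Mapping.keys c \<and> i \<noteq> j \<and>
     (\<exists>t r s. total_degree t = CARD('d) - 1 \<and>
        m_exp X (c - eps i) = eps (j, r) + t \<and>
        m_exp X (c - eps j) = eps (i, s) + t)"

definition LS ::
    "('n::finite \<Rightarrow> ('n \<Rightarrow>\<^sub>0 nat) \<Rightarrow> 'd::finite set) \<Rightarrow> ('n \<Rightarrow>\<^sub>0 nat) \<Rightarrow> ('n \<Rightarrow>\<^sub>0 nat) set set" where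
  "LS X c = {{c - eps i, c - eps j} | i j. linear_syzygy_edge X c i j}"


section \<open>The Schur module and the tableaux\<close>

text \<open>
  For \<open>F\<close> free over \<open>'r\<close> with basis \<open>f\<^sub>i\<close>, the direct sum of all \<open>\<And>\<^sup>a F \<otimes> S\<^sub>b(F)\<close> is the free
  module on the basis elements \<open>f\<^sub>J \<otimes> f\<^sup>\<alpha>\<close>, represented by the pairs \<open>(J, \<alpha>)\<close>.
\<close>

type_synonym ('n, 'r) wedge_sym = "('n set \<times> ('n \<Rightarrow>\<^sub>0 nat)) \<Rightarrow>\<^sub>0 'r"

definition scale :: "'r::comm_ring_1 \<Rightarrow> ('b \<Rightarrow>\<^sub>0 'r) \<Rightarrow> ('b \<Rightarrow>\<^sub>0 'r)" where
  "scale r x = Poly_Mapping.map ((*) r) x"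

lemma lookup_scale: "Poly_Mapping.lookup (scale r x) b = r * Poly_Mapping.lookup x b"
  by (simp add: scale_def map.rep_eq when_def)

lemma module_scale: "module (scale :: 'r::comm_ring_1 \<Rightarrow> ('b \<Rightarrow>\<^sub>0 'r) \<Rightarrow> ('b \<Rightarrow>\<^sub>0 'r))"
  by unfold_locales
    (auto intro!: poly_mapping_eqI simp: lookup_scale lookup_add algebra_simps)

definition wedge_sym_part :: "nat \<Rightarrow> nat \<Rightarrow> ('n::finite, 'r::comm_ring_1) wedge_sym set" where
  "wedge_sym_part a b =
     {x. \<forall>(J, \<alpha>)\<in>Poly_Mapping.keys x. card J = a \<and> total_degree \<alpha> = b}"

text \<open>
  Comultiplication sends \<open>f\<^sub>J\<close> to the sum over \<open>j \<in> J\<close> of \<open>\<plusminus> f\<^sub>J\<^sub>-\<^sub>j \<otimes> f\<^sub>j\<close>, the sign being that of moving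
  \<open>f\<^sub>j\<close> to the right end of the wedge product; then \<open>f\<^sub>j\<close> is multiplied into \<open>f\<^sup>\<alpha>\<close>.
\<close>

definition kappa_basis ::
    "'n::{finite,linorder} set \<times> ('n \<Rightarrow>\<^sub>0 nat) \<Rightarrow> ('n, 'r::comm_ring_1) wedge_sym" where
  "kappa_basis b = (case b of (J, \<alpha>) \<Rightarrow>
     (\<Sum>j\<in>J. Poly_Mapping.single (J - {j}, \<alpha> + eps j) ((-1) ^ card {l\<in>J. j < l})))"

text \<open>
  All \<open>\<kappa>\<^sub>a\<^sub>,\<^sub>b\<close> at once: \<open>\<kappa>\<^sub>a\<^sub>,\<^sub>b\<close> is the restriction to \<open>wedge_sym_part a b\<close>.
\<close>

definition kappa ::
    "('n::{finite,linorder}, 'r::comm_ring_1) wedge_sym \<Rightarrow> ('n, 'r) wedge_sym" where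
  "kappa x = (\<Sum>b\<in>Poly_Mapping.keys x. scale (Poly_Mapping.lookup x b) (kappa_basis b))"

definition schur_module ::
    "nat \<Rightarrow> nat \<Rightarrow> ('n::{finite,linorder}, 'r::comm_ring_1) wedge_sym set" where
  "schur_module a b = {x \<in> wedge_sym_part a b. kappa x = 0}"

definition multidegree :: "'n set \<times> ('n \<Rightarrow>\<^sub>0 nat) \<Rightarrow> 'n \<Rightarrow>\<^sub>0 nat" where
  "multidegree b = snd b + (\<Sum>j\<in>fst b. eps j)"

definition schur_module_le ::
    "('n \<Rightarrow> nat) \<Rightarrow> nat \<Rightarrow> nat \<Rightarrow> ('n::{finite,linorder}, 'r::comm_ring_1) wedge_sym set" where
  "schur_module_le u a b = {x \<in> schur_module a b.
     \<forall>z\<in>Poly_Mapping.keys x. \<forall>i. Poly_Mapping.lookup (multidegree z) i \<le> u i}"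

text \<open>
  For \<open>i < j\<close> the pair \<open>({i, j}, \<alpha>)\<close> is \<open>f\<^sub>i \<and> f\<^sub>j \<otimes> f\<^sup>\<alpha>\<close>. These elements live in
  \<open>wedge_sym_part 2 (d - 1)\<close>; they are viewed in \<open>schur_module 1 d\<close> by applying \<open>kappa\<close>.
\<close>

definition tab ::
    "('n::{finite,linorder} \<Rightarrow> nat) \<Rightarrow> ('n \<Rightarrow> ('n \<Rightarrow>\<^sub>0 nat) \<Rightarrow> 'd::finite set)
      \<Rightarrow> ('n, 'r::comm_ring_1) wedge_sym set" where
  "tab u X = {Poly_Mapping.single ({i, j}, c - eps i - eps j) 1 | c i j.
     c \<in> lattice_points u (CARD('d) + 1) \<and> i < j \<and> linear_syzygy_edge X c i j}"

end

theory Submission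
  imports Defs "HOL-Library.Product_Lexorder"
begin

text \<open>
  The syzygies of the generators \<open>x\<^sup>a\<close> of the restricted power are generated by the linear ones, which live in
  the down-graphs; in the down-graph of \<open>c\<close> they are the vectors with coefficient sum zero on its
  vertices, and so is the part of the Schur module of multidegree \<open>c\<close>. An edge contributes the
  difference of its end points, so the linear syzygy edges span exactly when they connect the
  down-graph.

  If \<open>sigma\<close> is regular on the quotient by \<open>J\<close>, then \<open>J \<inter> (sigma) = J \<cdot> (sigma)\<close>, and the indicator of the
  monomials lying over one component of a down-graph kills \<open>J \<cdot> (sigma)\<close>; this forces connectedness.
  Conversely, connectedness yields \<open>J \<inter> (sigma) = J \<cdot> (sigma)\<close>, which descends to initial segments of
  \<open>sigma\<close> by Nakayama's lemma and gives regularity.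
\<close>

section \<open>Pushing forward finitely supported functions\<close>

text \<open>Regularity concerns every initial segment of \<open>sigma\<close>, while connectedness
  only speaks about the full substitution of \<open>x_i\<close> for all \<open>x_ij\<close>: its
  kernel is the ideal of \<open>sigma\<close>, so there the intersection with J is spanned by
  differences of monomials of J with equal image. For a shorter segment the fibres are smaller and
  the paths leave them, which is why the equality is established for all of \<open>sigma\<close> and
  then has to descend. To make Nakayama's lemma an induction, a degree bound D on the cofactors is
  carried through all congruences of monomials. In the necessity proofs the indicator has to ignore
  the second index of a variable, so it is taken over all products \<open>x_lr\<close> times the
  generator m(c - eps l), with r arbitrary and l in one component. Two such products from different
  components could only coincide through a linear syzygy, that is, through an edge joining the
  components. In degree d + 1 the monomials of J are a variable times a generator, so nothing else
  can interfere.\<close>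

lemma poly_mapping_sum_singles:
  "p = (\<Sum>t\<in>Poly_Mapping.keys p. Poly_Mapping.single t (Poly_Mapping.lookup p t))"
proof (rule poly_mapping_eqI)
  fix s
  have "Poly_Mapping.lookup p s = (\<Sum>t\<in>Poly_Mapping.keys p. Poly_Mapping.lookup p t when t = s)"
    by (simp add: when_def in_keys_iff)
  then show "Poly_Mapping.lookup p s = Poly_Mapping.lookup
      (\<Sum>t\<in>Poly_Mapping.keys p. Poly_Mapping.single t (Poly_Mapping.lookup p t)) s"
    by (simp add: lookup_sum lookup_single)
qed

lemma poly_mapping_add_induct [case_names zero single add]:
  fixes p :: "'a \<Rightarrow>\<^sub>0 'b::comm_monoid_add"
  assumes "P 0" and "\<And>t c. P (Poly_Mapping.single t c)" and "\<And>p q. P p \<Longrightarrow> P q \<Longrightarrow> P (p + q)"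
  shows "P p"
proof -
  have "P (\<Sum>t\<in>A. Poly_Mapping.single t (Poly_Mapping.lookup p t))" if "finite A" for A
    using that by (induction A) (simp_all add: assms)
  then show ?thesis
    by (metis finite_keys poly_mapping_sum_singles)
qed

lemma exponent_induct [case_names zero eps]:
  fixes t :: "'v \<Rightarrow>\<^sub>0 nat"
  assumes "P 0" and "\<And>v t. P t \<Longrightarrow> P (eps v + t)"
  shows "P t"
proof -
  have *: "P (Poly_Mapping.single v n + s)" if "P s" for v n s
  proof (induction n)
    case (Suc n)
    have "Poly_Mapping.single v (Suc n) = eps v + Poly_Mapping.single v n"
      by (metis single_add plus_1_eq_Suc)
    then show ?case
      using assms(2)[OF Suc] by (simp add: add.assoc)
  qed (use that in simp)
  have "\<forall>s. P s \<longrightarrow> P (t + s)"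
    by (induction t rule: poly_mapping_add_induct) (auto simp: * add.assoc)
  then show ?thesis
    using assms(1) by (metis add.right_neutral)
qed

text \<open>Used at two levels: on exponent vectors, where \<open>h\<close> maps variables, and on
  polynomials, where \<open>h\<close> maps exponent vectors. Thus \<open>push (push g)\<close> is
  the substitution of the variable \<open>g v\<close> for \<open>v\<close>, and
  \<open>depolarize\<close> is \<open>push (push fst)\<close>.\<close>

definition push :: "('a \<Rightarrow> 'b) \<Rightarrow> ('a \<Rightarrow>\<^sub>0 'c::comm_monoid_add) \<Rightarrow> 'b \<Rightarrow>\<^sub>0 'c" where
  "push h p = (\<Sum>t\<in>Poly_Mapping.keys p. Poly_Mapping.single (h t) (Poly_Mapping.lookup p t))"

lemma push_zero [simp]: "push h 0 = 0"
  by (simp add: push_def)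

lemma push_single [simp]: "push h (Poly_Mapping.single t c) = Poly_Mapping.single (h t) c"
  by (simp add: push_def)

lemma push_add: "push h (p + q) = push h p + push h q"
  unfolding push_def by (rule setsum_keys_plus_distrib) (simp_all add: single_add)

lemma push_sum: "push h (sum f A) = (\<Sum>x\<in>A. push h (f x))"
  by (induction A rule: infinite_finite_induct) (simp_all add: push_add)

lemma push_diff: "push h (p - q) = push h p - push h (q :: _ \<Rightarrow>\<^sub>0 'c::ab_group_add)"
  by (metis add_diff_cancel_right' diff_add_cancel push_add)

lemma push_push: "push g (push h p) = push (\<lambda>t. g (h t)) p"
  by (induction p rule: poly_mapping_add_induct) (simp_all add: push_add)

lemma push_ident [simp]: "push (\<lambda>t. t) p = p"
  by (simp add: push_def flip: poly_mapping_sum_singles)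

lemma push_mult:
  fixes p q :: "'a::monoid_add \<Rightarrow>\<^sub>0 'c::comm_semiring_0"
  assumes "\<And>s t. h (s + t) = h s + h t"
  shows "push h (p * q) = push h p * push h q"
proof (induction p rule: poly_mapping_add_induct)
  case (single t c)
  show ?case
    by (induction q rule: poly_mapping_add_induct)
      (simp_all add: mult_single assms push_add distrib_left)
qed (simp_all add: push_add distrib_right)

section \<open>Total degree and unit exponent vectors\<close>

lemma total_degree_zero [simp]: "total_degree 0 = 0"
  by (simp add: total_degree_def)

lemma total_degree_single [simp]: "total_degree (Poly_Mapping.single v n) = n"
  by (simp add: total_degree_def lookup_single when_def)

lemma total_degree_add: "total_degree (s + t) = total_degree s + total_degree t"
  by (simp add: total_degree_def lookup_add sum.distrib)

lemma total_degree_eq_0_iff: "total_degree t = 0 \<longleftrightarrow> t = 0"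
  by (auto simp: total_degree_def intro: poly_mapping_eqI)

lemma total_degree_push: "total_degree (push h t) = total_degree t"
  by (induction t rule: poly_mapping_add_induct) (simp_all add: push_add total_degree_add)

lemma eps_add_minus: "i \<in> Poly_Mapping.keys c \<Longrightarrow> eps i + (c - eps i) = c"
  by (rule poly_mapping_eqI)
    (auto simp: lookup_add lookup_minus lookup_single in_keys_iff when_def)

lemma total_degree_minus_eps:
  "i \<in> Poly_Mapping.keys c \<Longrightarrow> total_degree (c - eps i) = total_degree c - 1"
  by (metis add_diff_cancel_left' eps_add_minus total_degree_add total_degree_single)

lemma eps_in_keys_add: "v \<in> Poly_Mapping.keys (eps v + t)"
  by (simp add: in_keys_iff lookup_add)

lemma minus_eps_inject:
  assumes "i \<in> Poly_Mapping.keys c" "j \<in> Poly_Mapping.keys c" "c - eps i = c - eps j"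
  shows "i = j"
  by (metis assms add_right_cancel eps_add_minus keys_single singletonD singletonI zero_neq_one)

section \<open>Ideals of polynomial rings\<close>

interpretation ring_module: module "(*) :: 'r::comm_ring_1 \<Rightarrow> 'r \<Rightarrow> 'r"
  by (rule module_times)

declare ring_module.scale_scale [simp del] \<comment> \<open>this is associativity from right to left\<close>

lemma depolarize_eq_push:
  fixes p :: "('n \<times> 'd, 'k::comm_ring_1) mpoly"
  shows "depolarize p = push (push fst) p"
proof -
  have "(\<Prod>v\<in>A. var (fst v) ^ Poly_Mapping.lookup t v)
      = (monomial (\<Sum>v\<in>A. Poly_Mapping.single (fst v) (Poly_Mapping.lookup t v)) :: ('n, 'k) mpoly)"
    if "finite A" for A and t :: "'n \<times> 'd \<Rightarrow>\<^sub>0 nat"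
  proof -
    have *: "var v ^ n = (monomial (Poly_Mapping.single v n) :: ('n, 'k) mpoly)" for v n
      by (induction n) (simp_all add: var_def monomial_def mult_single flip: single_add)
    show ?thesis
      using that by (induction A) (simp_all add: * monomial_def mult_single)
  qed
  then show ?thesis
    by (simp add: depolarize_def push_def monomial_def mult_single)
qed

lemma in_ideal_gen_monomials_iff:
  "f \<in> (ideal_gen (monomial ` G) :: ('v, 'k::comm_ring_1) mpoly set) \<longleftrightarrow>
     Poly_Mapping.keys f \<subseteq> {s + a | s a. a \<in> G}"
proof
  let ?M = "{s + a | s a. a \<in> G}"
  have "ring_module.subspace {f :: ('v, 'k) mpoly. Poly_Mapping.keys f \<subseteq> ?M}"
  proof (rule ring_module.subspaceI)
    fix c x :: "('v, 'k) mpoly"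
    assume "x \<in> {f. Poly_Mapping.keys f \<subseteq> ?M}"
    moreover have "s + (s' + a) \<in> ?M" if "a \<in> G" for s s' a
      using that by (force simp flip: add.assoc)
    ultimately show "c * x \<in> {f. Poly_Mapping.keys f \<subseteq> ?M}"
      using keys_mult[of c x] by fastforce
  qed (use keys_add in \<open>force+\<close>)
  moreover have "monomial ` G \<subseteq> {f :: ('v, 'k) mpoly. Poly_Mapping.keys f \<subseteq> ?M}"
    by (auto simp: monomial_def) (metis add.left_neutral)
  ultimately have "ideal_gen (monomial ` G) \<subseteq> {f :: ('v, 'k) mpoly. Poly_Mapping.keys f \<subseteq> ?M}"
    unfolding ideal_gen_def by (rule ring_module.span_minimal[rotated])
  then show "f \<in> ideal_gen (monomial ` G) \<Longrightarrow> Poly_Mapping.keys f \<subseteq> ?M"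
    by blast
next
  assume keys: "Poly_Mapping.keys f \<subseteq> {s + a | s a. a \<in> G}"
  have "Poly_Mapping.single t c \<in> (ideal_gen (monomial ` G) :: ('v, 'k) mpoly set)"
    if "t \<in> {s + a | s a. a \<in> G}" for t c
  proof -
    from that obtain s a where "a \<in> G" "t = s + a"
      by blast
    then have "Poly_Mapping.single t c = Poly_Mapping.single s c * (monomial a :: ('v, 'k) mpoly)"
      by (simp add: monomial_def mult_single)
    with \<open>a \<in> G\<close> show ?thesis
      unfolding ideal_gen_def by (simp add: ring_module.span_scale ring_module.span_base)
  qed
  with keys have "(\<Sum>t\<in>Poly_Mapping.keys f. Poly_Mapping.single t (Poly_Mapping.lookup f t))
      \<in> ideal_gen (monomial ` G)"
    unfolding ideal_gen_def by (intro ring_module.span_sum) blast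
  then show "f \<in> ideal_gen (monomial ` G)"
    by (simp flip: poly_mapping_sum_singles)
qed

definition binomial_diff :: "('v \<Rightarrow> 'v) \<Rightarrow> 'v \<Rightarrow> ('v, 'k::comm_ring_1) mpoly" where
  "binomial_diff b v = var (b v) - var v"

text \<open>The substitution that divides out the differences indexed by \<open>W\<close>. When
  \<open>b\<close> maps \<open>W\<close> outside \<open>W\<close>, its image is the polynomial ring
  in the variables outside \<open>W\<close>.\<close>

definition collapse :: "('v \<Rightarrow> 'v) \<Rightarrow> 'v set \<Rightarrow> 'v \<Rightarrow> 'v" where
  "collapse b W v = (if v \<in> W then b v else v)"

text \<open>The variables are replaced one at a time, and each replacement costs a multiple of one
  generator.\<close>

lemma monomial_diff_collapse:
  "monomial t - monomial (push (collapse b W) t) \<in> (ideal_gen (binomial_diff b ` W) :: ('v, 'k::comm_ring_1) mpoly set)"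
proof (induction t rule: exponent_induct)
  case zero
  then show ?case
    by (simp add: ideal_gen_def ring_module.span_zero)
next
  case (eps v t)
  let ?g = "collapse b W" and ?I = "ideal_gen (binomial_diff b ` W) :: ('v, 'k) mpoly set"
  have "var v - var (?g v) \<in> ?I"
  proof (cases "v \<in> W")
    case True
    then have "binomial_diff b v \<in> ?I"
      by (simp add: ideal_gen_def ring_module.span_base)
    then have "- binomial_diff b v \<in> ?I"
      unfolding ideal_gen_def by (rule ring_module.span_neg)
    then show ?thesis
      using True by (simp add: binomial_diff_def collapse_def)
  qed (simp add: collapse_def ideal_gen_def ring_module.span_zero)
  then have "monomial t * (var v - var (?g v)) + var (?g v) * (monomial t - monomial (push ?g t)) \<in> ?I"
    using eps unfolding ideal_gen_def by (intro ring_module.span_add ring_module.span_scale)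
  moreover have "monomial t * (var v - var (?g v)) + var (?g v) * (monomial t - monomial (push ?g t))
      = (monomial (eps v + t) - monomial (push ?g (eps v + t)) :: ('v, 'k) mpoly)"
    by (simp add: var_def monomial_def algebra_simps mult_single push_add)
  ultimately show ?case
    by simp
qed

text \<open>Modulo the ideal, \<open>f\<close> equals its collapse, so a vanishing collapse puts
  \<open>f\<close> into the ideal. Conversely, disjointness makes \<open>b w\<close> a fixed point
  of \<open>collapse b W\<close>, so the two variables of each generator get the same image.\<close>

lemma in_ideal_gen_binomial_diff_iff:
  fixes f :: "('v, 'k::comm_ring_1) mpoly"
  assumes "b ` W \<inter> W = {}"
  shows "f \<in> ideal_gen (binomial_diff b ` W) \<longleftrightarrow> push (push (collapse b W)) f = 0"
proof
  let ?h = "push (push (collapse b W)) :: ('v, 'k) mpoly \<Rightarrow> _"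
  have "ring_module.subspace {f. ?h f = 0}"
    by (rule ring_module.subspaceI) (simp_all add: push_add push_mult)
  moreover have "binomial_diff b ` W \<subseteq> {f. ?h f = 0}"
    using assms by (fastforce simp: binomial_diff_def var_def monomial_def push_diff collapse_def)
  ultimately have "ideal_gen (binomial_diff b ` W) \<subseteq> {f. ?h f = 0}"
    unfolding ideal_gen_def by (rule ring_module.span_minimal[rotated])
  then show "f \<in> ideal_gen (binomial_diff b ` W) \<Longrightarrow> ?h f = 0"
    by blast
next
  let ?I = "ideal_gen (binomial_diff b ` W) :: ('v, 'k) mpoly set"
  assume "push (push (collapse b W)) f = 0"
  moreover have "f - push (push (collapse b W)) f \<in> ?I"
  proof (induction f rule: poly_mapping_add_induct)
    case zero
    show ?case
      by (simp add: ideal_gen_def ring_module.span_zero)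
  next
    case (single t c)
    have "Poly_Mapping.single t c - push (push (collapse b W)) (Poly_Mapping.single t c)
        = Poly_Mapping.single 0 c * (monomial t - monomial (push (collapse b W) t))"
      by (simp add: right_diff_distrib monomial_def mult_single)
    then show ?case
      using monomial_diff_collapse unfolding ideal_gen_def by (metis ring_module.span_scale)
  next
    case (add p q)
    then have "(p - push (push (collapse b W)) p) + (q - push (push (collapse b W)) q) \<in> ?I"
      unfolding ideal_gen_def by (rule ring_module.span_add)
    then show ?case
      by (simp add: push_add algebra_simps)
  qed
  ultimately show "f \<in> ?I"
    by simp
qed

text \<open>Collapsing along \<open>W\<close> fixes both \<open>v\<close> and \<open>b v\<close>, so
  the difference stays a nonzero element of a polynomial ring over a domain. The order on the
  variables serves to order the exponent vectors, which is how the polynomial ring is known to have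
  no zero divisors.\<close>

lemma binomial_diff_regular:
  fixes f :: "('v::linorder, 'k::idom) mpoly"
  assumes W: "\<And>w. w \<in> insert v W \<Longrightarrow> b w \<notin> insert v W" and "v \<notin> W"
    and f: "binomial_diff b v * f \<in> ideal_gen (binomial_diff b ` W)"
  shows "f \<in> ideal_gen (binomial_diff b ` W)"
proof -
  have disj: "b ` W \<inter> W = {}"
    using W by auto
  let ?h = "push (push (collapse b W)) :: ('v, 'k) mpoly \<Rightarrow> _"
  have "?h (binomial_diff b v * f) = binomial_diff b v * ?h f"
    using W[of v] \<open>v \<notin> W\<close>
    by (simp add: push_add push_mult push_diff binomial_diff_def var_def monomial_def collapse_def)
  with f have "binomial_diff b v * ?h f = 0"
    by (simp add: in_ideal_gen_binomial_diff_iff[OF disj])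
  moreover have "binomial_diff b v \<noteq> (0 :: ('v, 'k) mpoly)"
  proof
    assume "binomial_diff b v = (0 :: ('v, 'k) mpoly)"
    then have "Poly_Mapping.keys (var (b v) :: ('v, 'k) mpoly) = Poly_Mapping.keys (var v :: ('v, 'k) mpoly)"
      by (simp add: binomial_diff_def)
    then have "Poly_Mapping.keys (eps (b v)) = Poly_Mapping.keys (eps v)"
      by (simp add: var_def monomial_def)
    then show False
      using W[of v] by simp
  qed
  ultimately show ?thesis
    by (simp add: in_ideal_gen_binomial_diff_iff[OF disj])
qed

text \<open>The coefficients of \<open>f\<close> sum to zero on every fibre of \<open>h\<close>.
  Moving each of them to one representative of its fibre therefore subtracts zero in total and
  writes \<open>f\<close> as a sum of differences inside fibres. This serves polynomials, with
  \<open>h\<close> a substitution, and the Schur module, with \<open>h\<close> the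
  multidegree.\<close>

lemma in_submonoid_if_push_eq_0:
  fixes f :: "'a \<Rightarrow>\<^sub>0 'c::ab_group_add"
  assumes "push h f = 0" and "0 \<in> N" and add: "\<And>x y. x \<in> N \<Longrightarrow> y \<in> N \<Longrightarrow> x + y \<in> N"
    and fibre: "\<And>s t c. s \<in> Poly_Mapping.keys f \<Longrightarrow> t \<in> Poly_Mapping.keys f \<Longrightarrow> h s = h t \<Longrightarrow>
      Poly_Mapping.single s c - Poly_Mapping.single t c \<in> N"
  shows "f \<in> N"
proof -
  define rep where "rep y = (SOME t. t \<in> Poly_Mapping.keys f \<and> h t = y)" for y
  have rep: "rep (h t) \<in> Poly_Mapping.keys f \<and> h (rep (h t)) = h t" if "t \<in> Poly_Mapping.keys f" for t
    unfolding rep_def using that by (rule_tac someI[of _ t]) simp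
  have "(\<Sum>t\<in>A. Poly_Mapping.single t (Poly_Mapping.lookup f t)
      - Poly_Mapping.single (rep (h t)) (Poly_Mapping.lookup f t)) \<in> N"
    if "A \<subseteq> Poly_Mapping.keys f" for A
    using finite_subset[OF that finite_keys] that
    by (induction A) (simp_all add: \<open>0 \<in> N\<close> add fibre rep)
  from this[OF subset_refl] show ?thesis
    using \<open>push h f = 0\<close> push_push[of rep h f] poly_mapping_sum_singles[of f]
    unfolding sum_subtractf push_def[of "\<lambda>t. rep (h t)", symmetric] by simp
qed

section \<open>Regular sequences of differences of variables\<close>

text \<open>For \<open>M\<close> closed under adding exponents, this is a truncated monomial ideal.
  The bound is strict so that \<open>D = 0\<close> leaves only the zero polynomial, which anchors
  the descent below.\<close>

definition monomial_trunc :: "('v::finite \<Rightarrow>\<^sub>0 nat) set \<Rightarrow> nat \<Rightarrow> ('v, 'k::comm_ring_1) mpoly set" where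
  "monomial_trunc M D = {f. \<forall>t\<in>Poly_Mapping.keys f. t \<in> M \<and> total_degree t < D}"

text \<open>The product of the monomial ideal and the ideal of the differences, with the degree
  bound imposed on the cofactors: these are what the descent recurses on. The elements themselves
  have degree at most \<open>D\<close>.\<close>

definition syzygy_trunc ::
    "('v \<Rightarrow> 'v) \<Rightarrow> 'v set \<Rightarrow> ('v::finite \<Rightarrow>\<^sub>0 nat) set \<Rightarrow> nat \<Rightarrow> ('v, 'k::comm_ring_1) mpoly set" where
  "syzygy_trunc b W M D = {\<Sum>w\<in>W. binomial_diff b w * h w | h. \<forall>w\<in>W. h w \<in> monomial_trunc M D}"

lemma monomial_trunc_zero [simp]: "0 \<in> monomial_trunc M D"
  by (simp add: monomial_trunc_def)

lemma monomial_trunc_add: "f \<in> monomial_trunc M D \<Longrightarrow> g \<in> monomial_trunc M D \<Longrightarrow> f + g \<in> monomial_trunc M D"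
  using keys_add[of f g] by (auto simp: monomial_trunc_def)

lemma monomial_trunc_mult_single_0:
  "f \<in> monomial_trunc M D \<Longrightarrow> Poly_Mapping.single 0 c * f \<in> monomial_trunc M D"
  using keys_mult[of "Poly_Mapping.single 0 c" f] by (fastforce simp: monomial_trunc_def split: if_splits)

lemma monomial_trunc_0: "f \<in> monomial_trunc M 0 \<Longrightarrow> f = 0"
  by (auto simp: monomial_trunc_def simp flip: keys_eq_empty)

lemma monomial_trunc_binomial_diff_mult:
  assumes "\<And>s t. t \<in> M \<Longrightarrow> s + t \<in> M" "f \<in> monomial_trunc M D"
  shows "binomial_diff b v * f \<in> monomial_trunc M (Suc D)"
proof -
  have "t \<in> M \<and> total_degree t < Suc D" if "t \<in> Poly_Mapping.keys (var w * f)" for w t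
    using that keys_mult[of "var w" f] assms
    by (fastforce simp: monomial_trunc_def var_def monomial_def total_degree_add split: if_splits)
  then show ?thesis
    using keys_diff[of "var (b v) * f" "var v * f"]
    by (auto simp: monomial_trunc_def binomial_diff_def left_diff_distrib)
qed

lemma syzygy_trunc_zero: "0 \<in> syzygy_trunc b W M D"
  by (auto simp: syzygy_trunc_def intro!: exI[of _ "\<lambda>_. 0"])

lemma syzygy_trunc_add:
  assumes "f \<in> syzygy_trunc b W M D" "g \<in> syzygy_trunc b W M D"
  shows "f + g \<in> syzygy_trunc b W M D"
proof -
  obtain h h' where h: "\<forall>w\<in>W. h w \<in> monomial_trunc M D" "f = (\<Sum>w\<in>W. binomial_diff b w * h w)"
    and h': "\<forall>w\<in>W. h' w \<in> monomial_trunc M D" "g = (\<Sum>w\<in>W. binomial_diff b w * h' w)"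
    using assms by (auto simp: syzygy_trunc_def)
  then have "f + g = (\<Sum>w\<in>W. binomial_diff b w * (h w + h' w))"
    by (simp add: distrib_left sum.distrib)
  with h h' show ?thesis
    by (auto simp: syzygy_trunc_def intro!: exI[of _ "\<lambda>w. h w + h' w"] monomial_trunc_add)
qed

lemma syzygy_trunc_mult_single_0:
  assumes "f \<in> syzygy_trunc b W M D"
  shows "Poly_Mapping.single 0 c * f \<in> syzygy_trunc b W M D"
proof -
  obtain h where h: "\<forall>w\<in>W. h w \<in> monomial_trunc M D" "f = (\<Sum>w\<in>W. binomial_diff b w * h w)"
    using assms by (auto simp: syzygy_trunc_def)
  then have "Poly_Mapping.single 0 c * f
      = (\<Sum>w\<in>W. binomial_diff b w * (Poly_Mapping.single 0 c * h w))"
    by (simp add: sum_distrib_left ac_simps)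
  with h show ?thesis
    by (auto simp: syzygy_trunc_def intro!: exI[of _ "\<lambda>w. Poly_Mapping.single 0 c * h w"]
        monomial_trunc_mult_single_0)
qed

lemma syzygy_trunc_uminus: "f \<in> syzygy_trunc b W M D \<Longrightarrow> - f \<in> syzygy_trunc b W M D"
  using syzygy_trunc_mult_single_0[of f b W M D "- 1"] by (simp add: single_uminus)

lemma syzygy_trunc_binomial_diff:
  assumes "finite W" "w \<in> W" "f \<in> monomial_trunc M D"
  shows "binomial_diff b w * f \<in> syzygy_trunc b W M D"
proof -
  have "(\<Sum>v\<in>W. binomial_diff b v * (if v = w then f else 0)) = (\<Sum>v\<in>W. if v = w then binomial_diff b w * f else 0)"
    by (rule sum.cong) auto
  then have "binomial_diff b w * f = (\<Sum>v\<in>W. binomial_diff b v * (if v = w then f else 0))"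
    using assms by simp
  then show ?thesis
    using assms(3) by (auto simp: syzygy_trunc_def intro!: exI[of _ "\<lambda>v. if v = w then f else 0"])
qed

lemma sum_binomial_diff_in_ideal_gen:
  "(\<Sum>w\<in>W. binomial_diff b w * h w) \<in> ideal_gen (binomial_diff b ` W)"
  unfolding ideal_gen_def
  by (rule ring_module.span_sum)
    (metis imageI mult.commute ring_module.span_base ring_module.span_scale)

text \<open>
  Nakayama's lemma for the grading, carried out as an induction on the degree bound: if the
  relation \<open>binomial_diff b x * h\<close> vanishes modulo fewer differences, so does \<open>h\<close>, whose degree
  is smaller.
\<close>

lemma syzygy_trunc_descend:
  fixes M :: "('v::{finite,linorder} \<Rightarrow>\<^sub>0 nat) set"
  assumes up: "\<And>s t. t \<in> M \<Longrightarrow> s + t \<in> M"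
    and V: "\<And>v. v \<in> V \<Longrightarrow> b v \<notin> V"
    and base: "\<And>D f. f \<in> monomial_trunc M (Suc D) \<Longrightarrow> f \<in> ideal_gen (binomial_diff b ` V) \<Longrightarrow>
      f \<in> (syzygy_trunc b V M D :: ('v, 'k::idom) mpoly set)"
    and "W \<subseteq> V" "f \<in> monomial_trunc M (Suc D)" "f \<in> ideal_gen (binomial_diff b ` W)"
  shows "f \<in> (syzygy_trunc b W M D :: ('v, 'k) mpoly set)"
  using \<open>W \<subseteq> V\<close> \<open>f \<in> monomial_trunc M (Suc D)\<close> \<open>f \<in> ideal_gen (binomial_diff b ` W)\<close>
proof (induction D arbitrary: W f rule: less_induct)
  case (less D)
  \<comment> \<open>An inner induction on the set \<open>U\<close> of dropped differences, starting
    with \<open>base\<close> for all of \<open>V\<close>; the outer induction hypothesis, for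
    smaller \<open>D\<close>, remains available for every subset of \<open>V\<close>.\<close>
  have "f \<in> syzygy_trunc b (V - U) M D"
    if "finite U" "U \<subseteq> V" "f \<in> monomial_trunc M (Suc D)" "f \<in> ideal_gen (binomial_diff b ` (V - U))"
    for U and f :: "('v, 'k) mpoly"
    using that
  proof (induction U arbitrary: f)
    case empty
    then show ?case
      by (simp add: base)
  next
    case (insert x U)
    let ?W = "V - insert x U"
    have ins: "V - U = insert x ?W"
      using insert by blast
    have "f \<in> ideal_gen (binomial_diff b ` (V - U))"
      using insert.prems(3) unfolding ideal_gen_def
      by (rule subsetD[OF ring_module.span_mono, rotated]) blast
    with insert have "f \<in> syzygy_trunc b (V - U) M D"
      by simp
    then obtain h where h: "\<forall>w\<in>insert x ?W. h w \<in> monomial_trunc M D"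
      and "f = (\<Sum>w\<in>insert x ?W. binomial_diff b w * h w)"
      unfolding ins by (auto simp: syzygy_trunc_def)
    then have f: "f = binomial_diff b x * h x + (\<Sum>w\<in>?W. binomial_diff b w * h w)"
      by simp
    \<comment> \<open>Modulo the smaller set only the term of \<open>x\<close> is left, and
      \<open>f\<close> itself vanishes there; the factor \<open>binomial_diff b x\<close> can then
      be cancelled.\<close>
    have "f - (\<Sum>w\<in>?W. binomial_diff b w * h w) \<in> ideal_gen (binomial_diff b ` ?W)"
      using insert.prems(3) sum_binomial_diff_in_ideal_gen[of b h ?W]
      unfolding ideal_gen_def by (rule ring_module.span_diff)
    then have "binomial_diff b x * h x \<in> ideal_gen (binomial_diff b ` ?W)"
      by (simp add: f)
    then have hx: "h x \<in> ideal_gen (binomial_diff b ` ?W)"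
    proof (rule binomial_diff_regular[rotated 2])
      show "b w \<notin> insert x ?W" if "w \<in> insert x ?W" for w
        using V[of w] that insert.prems(1) by blast
    qed simp
    \<comment> \<open>The outer hypothesis at \<open>D - 1\<close> gives \<open>h x\<close>
      cofactors of degree below \<open>D - 1\<close>; the extra factor
      \<open>binomial_diff b x\<close> raises this to \<open>D\<close>, so they can be absorbed into
      the other cofactors without loss.\<close>
    obtain h' where h': "\<forall>w\<in>?W. binomial_diff b x * h' w \<in> monomial_trunc M D"
      "h x = (\<Sum>w\<in>?W. binomial_diff b w * h' w)"
    proof (cases D)
      case 0
      then have "h x = 0"
        using h monomial_trunc_0 by blast
      then show ?thesis
        using that[of "\<lambda>_. 0"] by simp
    next
      case (Suc D')
      then have "h x \<in> syzygy_trunc b ?W M D'"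
        using h hx by (intro less.IH) auto
      then obtain h' where h': "\<forall>w\<in>?W. h' w \<in> monomial_trunc M D'"
        "h x = (\<Sum>w\<in>?W. binomial_diff b w * h' w)"
        by (auto simp: syzygy_trunc_def)
      have "\<forall>w\<in>?W. binomial_diff b x * h' w \<in> monomial_trunc M D"
        using h'(1) unfolding Suc by (simp add: monomial_trunc_binomial_diff_mult up)
      then show ?thesis
        using h'(2) by (rule that)
    qed
    have "f = (\<Sum>w\<in>?W. binomial_diff b w * (binomial_diff b x * h' w + h w))"
      unfolding f h'(2) sum_distrib_left distrib_left sum.distrib
      by (intro arg_cong2[where f = plus] sum.cong refl mult.left_commute)
    moreover have "\<forall>w\<in>?W. binomial_diff b x * h' w + h w \<in> monomial_trunc M D"
      using h h'(1) by (blast intro: monomial_trunc_add)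
    ultimately show ?case
      unfolding syzygy_trunc_def mem_Collect_eq by (intro exI conjI)
  qed
  note claim = this
  have "V - (V - W) = W"
    using less.prems(1) by blast
  then show ?case
    using claim[OF finite Diff_subset, of f W] less.prems(2,3) by argo
qed

text \<open>Write the product as j + k with j in the monomial ideal and k in the ideal of
  \<open>W\<close>. Then j lies in the intersection with the ideal of \<open>insert v W\<close>, so
  it is a combination of differences with cofactors \<open>h\<close> in the monomial ideal.
  Subtracting \<open>h v\<close> from \<open>p\<close> leaves a problem in the polynomial ring
  alone, where the difference is regular.\<close>

lemma binomial_diff_regular_mod_monomials:
  fixes G :: "('v::{finite,linorder} \<Rightarrow>\<^sub>0 nat) set"
  assumes V: "\<And>v. v \<in> V \<Longrightarrow> b v \<notin> V"
    and connected: "\<And>s t D. s \<in> {s + a | s a. a \<in> G} \<Longrightarrow> t \<in> {s + a | s a. a \<in> G} \<Longrightarrow>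
      push (collapse b V) s = push (collapse b V) t \<Longrightarrow> total_degree s \<le> D \<Longrightarrow>
      monomial s - monomial t \<in> (syzygy_trunc b V {s + a | s a. a \<in> G} D :: ('v, 'k::idom) mpoly set)"
    and W: "insert v W \<subseteq> V" "v \<notin> W"
    and p: "binomial_diff b v * p \<in> ideal_gen (ideal_gen (monomial ` G) \<union> binomial_diff b ` W)"
  shows "p \<in> (ideal_gen (ideal_gen (monomial ` G) \<union> binomial_diff b ` W) :: ('v, 'k) mpoly set)"
proof -
  let ?M = "{s + a | s a. a \<in> G}" and ?J = "ideal_gen (monomial ` G) :: ('v, 'k) mpoly set"
  have Un: "ideal_gen (?J \<union> B) = {x + y | x y. x \<in> ?J \<and> y \<in> ideal_gen B}" for B
    unfolding ideal_gen_def by (simp add: ring_module.span_Un ring_module.span_span)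
  have disj: "b ` V \<inter> V = {}"
    using V by auto
  have up: "s + t \<in> ?M" if "t \<in> ?M" for s t
    using that by (force simp flip: add.assoc)
  \<comment> \<open>An element of the ideal of all of \<open>V\<close> has coefficient sum zero on
    each fibre of the collapse, and \<open>connected\<close> handles differences inside a
    fibre.\<close>
  have base: "f \<in> syzygy_trunc b V ?M D"
    if f: "f \<in> monomial_trunc ?M (Suc D)" "f \<in> ideal_gen (binomial_diff b ` V)" for D and f :: "('v, 'k) mpoly"
  proof (rule in_submonoid_if_push_eq_0)
    show "push (push (collapse b V)) f = 0"
      using f(2) by (simp add: in_ideal_gen_binomial_diff_iff[OF disj])
    fix s t and c :: 'k
    assume "s \<in> Poly_Mapping.keys f" "t \<in> Poly_Mapping.keys f" "push (collapse b V) s = push (collapse b V) t"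
    with f(1) have "monomial s - monomial t \<in> (syzygy_trunc b V ?M D :: ('v, 'k) mpoly set)"
      by (intro connected) (auto simp: monomial_trunc_def)
    then have "Poly_Mapping.single 0 c * (monomial s - monomial t) \<in> syzygy_trunc b V ?M D"
      by (rule syzygy_trunc_mult_single_0)
    then show "Poly_Mapping.single s c - Poly_Mapping.single t c \<in> syzygy_trunc b V ?M D"
      by (simp add: monomial_def right_diff_distrib mult_single)
  qed (simp_all add: syzygy_trunc_zero syzygy_trunc_add)
  from p obtain j k where jk: "binomial_diff b v * p = j + k" "j \<in> ?J" "k \<in> ideal_gen (binomial_diff b ` W)"
    unfolding Un by blast
  \<comment> \<open>For \<open>j = 0\<close> the maximum is over the empty set and has no specified
    value; then there are no keys to bound.\<close>
  define D where "D = Max (total_degree ` Poly_Mapping.keys j)"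
  have "j \<in> monomial_trunc ?M (Suc D)"
    using jk(2) unfolding in_ideal_gen_monomials_iff monomial_trunc_def D_def
    by (auto simp: less_Suc_eq_le)
  moreover have "k \<in> ideal_gen (binomial_diff b ` insert v W)" "binomial_diff b v \<in> ideal_gen (binomial_diff b ` insert v W)"
    using jk(3) ring_module.span_mono[of "binomial_diff b ` W" "binomial_diff b ` insert v W"]
    unfolding ideal_gen_def by (auto intro: ring_module.span_base)
  then have "p * binomial_diff b v - k \<in> ideal_gen (binomial_diff b ` insert v W)"
    unfolding ideal_gen_def by (intro ring_module.span_diff ring_module.span_scale)
  then have "j \<in> ideal_gen (binomial_diff b ` insert v W)"
    using jk(1) by (simp add: algebra_simps)
  ultimately have "j \<in> syzygy_trunc b (insert v W) ?M D"
    using W by (intro syzygy_trunc_descend[OF up V base]) auto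
  then obtain h where h: "\<forall>w\<in>insert v W. h w \<in> monomial_trunc ?M D"
    and j: "j = (\<Sum>w\<in>insert v W. binomial_diff b w * h w)"
    by (auto simp: syzygy_trunc_def)
  then have "binomial_diff b v * (p - h v) = (\<Sum>w\<in>W. binomial_diff b w * h w) + k"
    using jk(1) W(2) finite_subset[OF W(1)] by (simp add: algebra_simps)
  also have "\<dots> \<in> ideal_gen (binomial_diff b ` W)"
    using sum_binomial_diff_in_ideal_gen jk(3) unfolding ideal_gen_def by (rule ring_module.span_add)
  finally have "p - h v \<in> ideal_gen (binomial_diff b ` W)"
  proof (rule binomial_diff_regular[rotated 2])
    show "b w \<notin> insert v W" if "w \<in> insert v W" for w
      using V[of w] that W by blast
  qed (fact W(2))
  moreover have "h v \<in> ?J"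
    using h unfolding in_ideal_gen_monomials_iff monomial_trunc_def by auto
  ultimately show ?thesis
    unfolding Un mem_Collect_eq by (intro exI[of _ "h v"] exI[of _ "p - h v"]) simp
qed

text \<open>A dual form of the equality of I \<inter> (rs) and I . (rs) for a sequence regular
  modulo I. If f = g r modulo the earlier elements, then r g lies in I plus their ideal, so
  regularity gives g = x + y with x in I and y in that ideal; f - r x is then in the intersection
  for a shorter segment. The functional is only additive, since a sum of selected coefficients is
  not linear over the polynomial ring.\<close>

lemma regular_sequence_mod_functional:
  fixes \<phi> :: "'r::comm_ring_1 \<Rightarrow> 'c::ab_group_add"
  assumes regular: "regular_sequence_mod I rs" and I: "module.subspace (*) I"
    and add: "\<And>x y. \<phi> (x + y) = \<phi> x + \<phi> y"
    and zero: "\<And>r x. r \<in> set rs \<Longrightarrow> x \<in> I \<Longrightarrow> \<phi> (x * r) = 0"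
    and f: "f \<in> I" "f \<in> ideal_gen (set rs)"
  shows "\<phi> f = 0"
proof -
  have "\<phi> f = 0" if "m \<le> length rs" "f \<in> I" "f \<in> ideal_gen (set (take m rs))" for m f
    using that
  proof (induction m arbitrary: f)
    case 0
    then show ?case
      using add[of 0 0] by (simp add: ideal_gen_def)
  next
    case (Suc m)
    let ?r = "rs ! m" and ?T = "set (take m rs)"
    have "set (take (Suc m) rs) = insert ?r ?T"
      using Suc.prems(1) by (simp add: take_Suc_conv_app_nth)
    with Suc.prems(3) obtain g where g: "f - g * ?r \<in> ideal_gen ?T"
      unfolding ideal_gen_def by (auto simp: ring_module.span_insert)
    have Un: "ideal_gen (I \<union> ?T) = {x + y | x y. x \<in> I \<and> y \<in> ideal_gen ?T}"
      using I unfolding ideal_gen_def by (simp add: ring_module.span_Un flip: ring_module.span_eq_iff)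
    have "- (f - g * ?r) \<in> ideal_gen ?T"
      using g unfolding ideal_gen_def by (rule ring_module.span_neg)
    then have "?r * g \<in> ideal_gen (I \<union> ?T)"
      unfolding Un using Suc.prems(2) by (force simp: mult.commute)
    then have "g \<in> ideal_gen (I \<union> ?T)"
      using regular Suc.prems(1) by (simp add: regular_sequence_mod_def)
    then obtain x y where xy: "g = x + y" "x \<in> I" "y \<in> ideal_gen ?T"
      unfolding Un by blast
    have "?r * y \<in> ideal_gen ?T"
      using xy(3) unfolding ideal_gen_def by (rule ring_module.span_scale)
    with g have "(f - g * ?r) + ?r * y \<in> ideal_gen ?T"
      unfolding ideal_gen_def by (intro ring_module.span_add)
    moreover have "(f - g * ?r) + ?r * y = f - ?r * x"
      by (simp add: xy(1) algebra_simps)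
    ultimately have "f - ?r * x \<in> ideal_gen ?T"
      by simp
    moreover have "f - ?r * x \<in> I"
      using I Suc.prems(2) xy(2) by (intro ring_module.subspace_diff ring_module.subspace_scale)
    ultimately have "\<phi> (f - ?r * x) = 0"
      using Suc by simp
    moreover have "\<phi> (x * ?r) = 0"
      using zero xy(2) Suc.prems(1) by simp
    ultimately show ?case
      using add[of "f - ?r * x" "?r * x"] by (simp add: mult.commute)
  qed
  from this[of "length rs" f] f show ?thesis
    by simp
qed

section \<open>Spanning trees\<close>

lemma connected_graph_mono: "connected_graph V E \<Longrightarrow> E \<subseteq> E' \<Longrightarrow> connected_graph V E'"
  unfolding connected_graph_def
  using rtrancl_mono[of "{(a, b). a \<in> V \<and> b \<in> V \<and> {a, b} \<in> E}" "{(a, b). a \<in> V \<and> b \<in> V \<and> {a, b} \<in> E'}"]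
  by blast

text \<open>The closing edge is bypassed by the rest of the cycle. That no other edge of the cycle
  equals it uses distinctness and length at least 3.\<close>

lemma connected_graph_remove_cycle_edge:
  assumes conn: "connected_graph V E" and "E \<subseteq> Pow V" and cycle: "graph_cycle E vs"
  shows "connected_graph V (E - {{last vs, hd vs}})"
proof -
  let ?e = "{last vs, hd vs}"
  let ?R = "\<lambda>E. {(a, b). a \<in> V \<and> b \<in> V \<and> {a, b} \<in> E}"
  have len: "3 \<le> length vs" and dist: "distinct vs"
    and edge: "\<And>m. m < length vs \<Longrightarrow> {vs ! m, vs ! (Suc m mod length vs)} \<in> E"
    using cycle by (auto simp: graph_cycle_def)
  have ne: "vs \<noteq> []"
    using len by auto
  have sym: "sym ((?R E')\<^sup>*)" for E'
    by (intro sym_rtrancl symI) (auto simp: insert_commute)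
  have "(vs ! 0, vs ! m) \<in> (?R (E - {?e}))\<^sup>*" if "m < length vs" for m
    using that
  proof (induction m)
    case (Suc m)
    have e: "{vs ! m, vs ! Suc m} \<in> E"
      using edge[of m] Suc.prems by simp
    moreover have "{vs ! m, vs ! Suc m} \<noteq> ?e"
    proof
      assume "{vs ! m, vs ! Suc m} = ?e"
      then have "vs ! m = vs ! 0 \<and> vs ! Suc m = vs ! (length vs - 1) \<or> vs ! m = vs ! (length vs - 1) \<and> vs ! Suc m = vs ! 0"
        using ne by (auto simp: doubleton_eq_iff last_conv_nth hd_conv_nth)
      then have "m = 0 \<and> Suc m = length vs - 1 \<or> m = length vs - 1 \<and> Suc m = 0"
        using dist Suc.prems ne by (subst (asm) (1 2 3 4) nth_eq_iff_index_eq) auto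
      with len show False
        by auto
    qed
    moreover have "vs ! m \<in> V" "vs ! Suc m \<in> V"
      using e \<open>E \<subseteq> Pow V\<close> by auto
    ultimately have "(vs ! m, vs ! Suc m) \<in> ?R (E - {?e})"
      by auto
    with Suc show ?case
      by (meson Suc_lessD rtrancl.rtrancl_into_rtrancl)
  qed simp
  from this[of "length vs - 1"] have path: "(hd vs, last vs) \<in> (?R (E - {?e}))\<^sup>*"
    using ne by (simp add: last_conv_nth hd_conv_nth)
  have "?R E \<subseteq> (?R (E - {?e}))\<^sup>*"
  proof clarify
    fix a b
    assume ab: "a \<in> V" "b \<in> V" "{a, b} \<in> E"
    show "(a, b) \<in> (?R (E - {?e}))\<^sup>*"
    proof (cases "{a, b} = ?e")
      case True
      then show ?thesis
        using path symD[OF sym path] by (auto simp: doubleton_eq_iff)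
    next
      case False
      with ab show ?thesis
        by (intro r_into_rtrancl) auto
    qed
  qed
  then have "(?R E)\<^sup>* \<subseteq> (?R (E - {?e}))\<^sup>*"
    by (rule rtrancl_subset_rtrancl)
  then show ?thesis
    using conn unfolding connected_graph_def by blast
qed

lemma connected_graph_contains_tree:
  assumes "connected_graph V E" "E \<subseteq> Pow V" "finite E"
  shows "\<exists>T\<subseteq>E. tree_graph V T"
  using assms(3,1,2)
proof (induction E rule: finite_psubset_induct)
  case (psubset E)
  show ?case
  proof (cases "\<exists>vs. graph_cycle E vs")
    case True
    then obtain vs where vs: "graph_cycle E vs"
      by blast
    then have "{vs ! (length vs - 1), vs ! (Suc (length vs - 1) mod length vs)} \<in> E" and ne: "vs \<noteq> []"
      unfolding graph_cycle_def by (force, auto)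
    then have "{last vs, hd vs} \<in> E"
      by (simp add: last_conv_nth hd_conv_nth)
    then have "E - {{last vs, hd vs}} \<subset> E"
      by blast
    from psubset.IH[OF this] connected_graph_remove_cycle_edge[OF psubset.prems vs] psubset.prems(2)
    show ?thesis
      by blast
  qed (use psubset.prems in \<open>auto simp: tree_graph_def\<close>)
qed

lemma spanning_tree_iff_connected:
  assumes "E \<subseteq> E'" "E' \<subseteq> Pow V" "finite E'"
  shows "(\<exists>T\<subseteq>E. spanning_tree_of V E' T) \<longleftrightarrow> connected_graph V E"
proof
  show "\<exists>T\<subseteq>E. spanning_tree_of V E' T \<Longrightarrow> connected_graph V E"
    by (auto simp: spanning_tree_of_def tree_graph_def intro: connected_graph_mono)
next
  assume "connected_graph V E"
  moreover have "E \<subseteq> Pow V" "finite E"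
    using assms finite_subset by auto
  ultimately show "\<exists>T\<subseteq>E. spanning_tree_of V E' T"
    using connected_graph_contains_tree[of V E] assms(1) unfolding spanning_tree_of_def by blast
qed

declare One_nat_def [simp del] \<comment> \<open>it would rewrite inside \<open>eps i\<close>\<close>

section \<open>Linear syzygy edges\<close>

abbreviation edge_rel ::
    "('n::finite \<Rightarrow> ('n \<Rightarrow>\<^sub>0 nat) \<Rightarrow> 'd::finite set) \<Rightarrow> ('n \<Rightarrow>\<^sub>0 nat) \<Rightarrow> ('n \<times> 'n) set" where
  "edge_rel X c \<equiv> {(i, j). linear_syzygy_edge X c i j}"

lemma linear_syzygy_edge_sym: "linear_syzygy_edge X c i j \<Longrightarrow> linear_syzygy_edge X c j i"
  unfolding linear_syzygy_edge_def by blast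

text \<open>The index \<open>i\<close> can be recovered from the vertex \<open>c - eps i\<close> on
  the support of \<open>c\<close>, so paths in the down-graph may be followed on indices, by
  \<open>edge_rel\<close>, instead of vertices.\<close>

lemma edge_in_LS_iff:
  assumes "i \<in> Poly_Mapping.keys c" "j \<in> Poly_Mapping.keys c"
  shows "{c - eps i, c - eps j} \<in> LS X c \<longleftrightarrow> linear_syzygy_edge X c i j"
proof
  assume "{c - eps i, c - eps j} \<in> LS X c"
  then obtain k l where kl: "{c - eps i, c - eps j} = {c - eps k, c - eps l}" "linear_syzygy_edge X c k l"
    unfolding LS_def by blast
  then have "k \<in> Poly_Mapping.keys c" "l \<in> Poly_Mapping.keys c"
    by (auto simp: linear_syzygy_edge_def)
  with kl(1) assms have "i = k \<and> j = l \<or> i = l \<and> j = k"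
    unfolding doubleton_eq_iff by (auto dest: minus_eps_inject)
  with kl(2) linear_syzygy_edge_sym show "linear_syzygy_edge X c i j"
    by blast
qed (auto simp: LS_def)

lemma connected_graph_down_iff:
  assumes "c \<noteq> 0"
  shows "connected_graph (down_verts c) (LS X c) \<longleftrightarrow>
    (\<forall>i\<in>Poly_Mapping.keys c. \<forall>j\<in>Poly_Mapping.keys c. (i, j) \<in> (edge_rel X c)\<^sup>*)"
proof -
  let ?R = "{(a, b). a \<in> down_verts c \<and> b \<in> down_verts c \<and> {a, b} \<in> LS X c}"
  have "(c - eps i, c - eps j) \<in> ?R\<^sup>* \<longleftrightarrow> (i, j) \<in> (edge_rel X c)\<^sup>*"
    if ij: "i \<in> Poly_Mapping.keys c" "j \<in> Poly_Mapping.keys c" for i j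
  proof
    assume "(c - eps i, c - eps j) \<in> ?R\<^sup>*"
    then have "\<exists>k\<in>Poly_Mapping.keys c. c - eps j = c - eps k \<and> (i, k) \<in> (edge_rel X c)\<^sup>*"
    proof (induction rule: rtrancl_induct)
      case (step y z)
      then obtain k l where "k \<in> Poly_Mapping.keys c" "l \<in> Poly_Mapping.keys c"
        "y = c - eps k" "z = c - eps l" "(i, k) \<in> (edge_rel X c)\<^sup>*" "{y, z} \<in> LS X c"
        unfolding down_verts_def by blast
      then show ?case
        using edge_in_LS_iff by (metis (mono_tags, lifting) case_prodI mem_Collect_eq rtrancl.rtrancl_into_rtrancl)
    qed (use ij in auto)
    then show "(i, j) \<in> (edge_rel X c)\<^sup>*"
      using ij(2) by (auto dest: minus_eps_inject)
  next
    assume "(i, j) \<in> (edge_rel X c)\<^sup>*"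
    then show "(c - eps i, c - eps j) \<in> ?R\<^sup>*"
    proof (induction rule: rtrancl_induct)
      case (step k l)
      then have "k \<in> Poly_Mapping.keys c" "l \<in> Poly_Mapping.keys c" "linear_syzygy_edge X c k l"
        by (auto simp: linear_syzygy_edge_def)
      then have "(c - eps k, c - eps l) \<in> ?R"
        by (auto simp: down_verts_def edge_in_LS_iff)
      with step.IH show ?case
        by (rule rtrancl_into_rtrancl)
    qed simp
  qed
  moreover have "down_verts c \<noteq> {}"
    using assms by (simp add: down_verts_def)
  ultimately show ?thesis
    unfolding connected_graph_def by (auto simp: down_verts_def)
qed

lemma lattice_points_minus_eps:
  assumes "c \<in> lattice_points u (e + 1)" "i \<in> Poly_Mapping.keys c"
  shows "c - eps i \<in> lattice_points u e"
  using assms total_degree_minus_eps[OF assms(2)]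
  by (auto simp: lattice_points_def lookup_minus intro: le_trans[OF diff_le_self])

lemma lattice_points_Suc_nonzero: "c \<in> lattice_points u (e + 1) \<Longrightarrow> c \<noteq> 0"
  by (auto simp: lattice_points_def)

lemma spanning_tree_LS_iff:
  assumes "c \<in> lattice_points u (e + 1)"
  shows "(\<exists>T\<subseteq>LS X c. spanning_tree_of (down_verts c) (down_edges c) T) \<longleftrightarrow>
    (\<forall>i\<in>Poly_Mapping.keys c. \<forall>j\<in>Poly_Mapping.keys c. (i, j) \<in> (edge_rel X c)\<^sup>*)"
proof -
  have "LS X c \<subseteq> down_edges c"
    unfolding LS_def down_edges_def linear_syzygy_edge_def by blast
  moreover have Pow: "down_edges c \<subseteq> Pow (down_verts c)"
    unfolding down_edges_def down_verts_def by blast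
  moreover have "finite (down_edges c)"
    by (rule finite_subset[OF Pow]) (simp add: down_verts_def)
  ultimately have "(\<exists>T\<subseteq>LS X c. spanning_tree_of (down_verts c) (down_edges c) T) \<longleftrightarrow>
      connected_graph (down_verts c) (LS X c)"
    by (rule spanning_tree_iff_connected)
  then show ?thesis
    using connected_graph_down_iff lattice_points_Suc_nonzero[OF assms] by blast
qed

section \<open>Linear syzygies and polarizations\<close>

abbreviation first_var :: "'n \<times> 'd::{finite,linorder} \<Rightarrow> 'n \<times> 'd" where
  "first_var v \<equiv> (fst v, Min UNIV)"

abbreviation other_vars :: "('n \<times> 'd::{finite,linorder}) set" where
  "other_vars \<equiv> {v. snd v \<noteq> Min UNIV}"

text \<open>A section of \<open>push fst\<close>, sending \<open>x_i\<close> to \<open>x_i1\<close>;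
  it supplies canonical lifts of cofactors.\<close>

abbreviation at_first :: "('n \<Rightarrow>\<^sub>0 nat) \<Rightarrow> ('n \<times> 'd::{finite,linorder}) \<Rightarrow>\<^sub>0 nat" where
  "at_first w \<equiv> push (\<lambda>i. (i, Min UNIV)) w"

lemma collapse_other_vars [simp]: "collapse first_var other_vars = first_var"
  by (auto simp: collapse_def)

lemma push_fst_at_first [simp]: "push fst (at_first w) = w"
  by (simp add: push_push)

lemma push_first_var:
  fixes t :: "'n \<times> 'd::{finite,linorder} \<Rightarrow>\<^sub>0 nat"
  shows "push first_var t = at_first (push fst t)"
  by (simp add: push_push)

lemma push_first_var_eq_iff:
  fixes s t :: "'n \<times> 'd::{finite,linorder} \<Rightarrow>\<^sub>0 nat"
  shows "push first_var s = push first_var t \<longleftrightarrow> push fst s = push fst t"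
proof
  assume "push first_var s = push first_var t"
  then have "push fst (at_first (push fst s) :: 'n \<times> 'd \<Rightarrow>\<^sub>0 nat) = push fst (at_first (push fst t) :: 'n \<times> 'd \<Rightarrow>\<^sub>0 nat)"
    by (simp only: push_first_var)
  then show "push fst s = push fst t"
    by simp
qed (simp add: push_first_var)

text \<open>Regularity is tested at list positions; a distinct list of variables shows that the
  variable at position m is not among the earlier ones.\<close>

lemma sigma_eq_map:
  obtains vs :: "('n::{finite,linorder} \<times> 'd::{finite,linorder}) list"
  where "(sigma :: ('n \<times> 'd, 'k::comm_ring_1) mpoly list) = map (binomial_diff first_var) vs"
    "distinct vs" "set vs = other_vars"
proof
  let ?vs = "List.product (sorted_list_of_set UNIV) (sorted_list_of_set (UNIV - {Min UNIV})) :: ('n \<times> 'd) list"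
  show "(sigma :: ('n \<times> 'd, 'k) mpoly list) = map (binomial_diff first_var) ?vs"
    by (simp add: sigma_def product_concat_map map_concat comp_def binomial_diff_def)
  show "distinct ?vs"
    by (intro distinct_product) auto
  show "set ?vs = other_vars"
    by auto
qed

lemma set_sigma:
  "set (sigma :: ('n::{finite,linorder} \<times> 'd::{finite,linorder}, 'k::comm_ring_1) mpoly list)
    = binomial_diff first_var ` other_vars"
proof -
  obtain vs :: "('n \<times> 'd) list" where vs: "(sigma :: ('n \<times> 'd, 'k) mpoly list) = map (binomial_diff first_var) vs"
    "set vs = other_vars"
    by (rule sigma_eq_map)
  show ?thesis
    unfolding vs(1) set_map vs(2) ..
qed

lemma in_ideal_gen_sigma_iff:
  fixes f :: "('n::{finite,linorder} \<times> 'd::{finite,linorder}, 'k::comm_ring_1) mpoly"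
  shows "f \<in> ideal_gen (set sigma) \<longleftrightarrow> push (push first_var) f = 0"
  unfolding set_sigma by (subst in_ideal_gen_binomial_diff_iff) auto

abbreviation monomials_of_maps ::
    "('n::finite \<Rightarrow> nat) \<Rightarrow> ('n \<Rightarrow> ('n \<Rightarrow>\<^sub>0 nat) \<Rightarrow> 'd::finite set) \<Rightarrow> ('n \<times> 'd \<Rightarrow>\<^sub>0 nat) set" where
  "monomials_of_maps u X \<equiv> {s + a | s a. a \<in> m_exp X ` lattice_points u CARD('d)}"

abbreviation cong_mod :: "('v, 'k::comm_ring_1) mpoly set \<Rightarrow> ('v \<Rightarrow>\<^sub>0 nat) \<Rightarrow> ('v \<Rightarrow>\<^sub>0 nat) \<Rightarrow> bool" where
  "cong_mod N s t \<equiv> monomial s - monomial t \<in> N"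

locale rank_preserving_maps =
  fixes u :: "'n::{finite,linorder} \<Rightarrow> nat"
    and X :: "'n \<Rightarrow> ('n \<Rightarrow>\<^sub>0 nat) \<Rightarrow> 'd::{finite,linorder} set"
    and field_type :: "'k::field itself" \<comment> \<open>only fixes the type of the coefficients\<close>
  assumes rank_preserving:
    "a \<in> lattice_points u CARD('d) \<Longrightarrow> card (X i a) = Poly_Mapping.lookup a i"
begin

text \<open>This is the form in which rank preservation enters: m(a) is a lift of the monomial with
  exponent \<open>a\<close>, and in particular has degree d.\<close>

lemma push_fst_m_exp:
  assumes "a \<in> lattice_points u CARD('d)"
  shows "push fst (m_exp X a) = a"
proof -
  have "(\<Sum>j\<in>A. eps i) = Poly_Mapping.single i (card A)" if "finite A" for i :: 'n and A :: "'d set"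
    using that by (induction A) (simp_all add: One_nat_def flip: single_add)
  then have "push fst (m_exp X a) = (\<Sum>i\<in>UNIV. Poly_Mapping.single i (Poly_Mapping.lookup a i))"
    using assms by (simp add: m_exp_def push_sum rank_preserving)
  also have "\<dots> = (\<Sum>i\<in>Poly_Mapping.keys a. Poly_Mapping.single i (Poly_Mapping.lookup a i))"
    by (rule sum.mono_neutral_right) (auto simp: in_keys_iff)
  finally show ?thesis
    by (simp flip: poly_mapping_sum_singles)
qed

lemma total_degree_m_exp:
  assumes "a \<in> lattice_points u CARD('d)"
  shows "total_degree (m_exp X a) = CARD('d)"
  using push_fst_m_exp[OF assms] assms total_degree_push[of fst "m_exp X a"]
  by (simp add: lattice_points_def)

lemma ideal_of_maps_eq:
  "ideal_of_maps u X = ideal_gen (monomial ` m_exp X ` lattice_points u CARD('d))"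
  by (simp add: ideal_of_maps_def image_image)

lemma monomial_in_ideal_of_maps:
  "a \<in> lattice_points u CARD('d) \<Longrightarrow> monomial (s + m_exp X a) \<in> ideal_of_maps u X"
  unfolding ideal_of_maps_eq in_ideal_gen_monomials_iff by (auto simp: monomial_def)

text \<open>As \<open>i\<close> and \<open>j\<close> differ, the variable \<open>(j, s)\<close> must
  divide the generator on the left; cancelling it leaves the common cofactor. This is the converse
  reading of an edge: any coincidence of such multiples comes from one.\<close>

lemma linear_syzygy_edgeI:
  assumes c: "c \<in> lattice_points u (CARD('d) + 1)"
    and ij: "i \<in> Poly_Mapping.keys c" "j \<in> Poly_Mapping.keys c" "i \<noteq> j"
    and eq: "eps (i, r) + m_exp X (c - eps i) = eps (j, s) + m_exp X (c - eps j)"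
  shows "linear_syzygy_edge X c i j"
proof -
  let ?t = "m_exp X (c - eps i) - eps (j, s)"
  have "Poly_Mapping.lookup (eps (i, r) + m_exp X (c - eps i)) (j, s) \<noteq> 0"
    unfolding eq by (simp add: lookup_add)
  then have "(j, s) \<in> Poly_Mapping.keys (m_exp X (c - eps i))"
    using ij(3) by (simp add: lookup_add lookup_single in_keys_iff)
  then have i: "m_exp X (c - eps i) = eps (j, s) + ?t"
    by (simp add: eps_add_minus)
  with eq have "eps (j, s) + (eps (i, r) + ?t) = eps (j, s) + m_exp X (c - eps j)"
    by (metis add.left_commute)
  then have j: "m_exp X (c - eps j) = eps (i, r) + ?t"
    by simp
  have "total_degree (eps (j, s) + ?t) = CARD('d)"
    using total_degree_m_exp[OF lattice_points_minus_eps[OF c ij(1)]] i by simp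
  then have "total_degree ?t = CARD('d) - 1"
    by (simp add: total_degree_add)
  with i j ij show ?thesis
    unfolding linear_syzygy_edge_def by blast
qed

section \<open>Congruence of monomials modulo the product of J and the ideal of
  \<open>sigma\<close>\<close>

abbreviation syz :: "nat \<Rightarrow> ('n \<times> 'd, 'k) mpoly set" where
  "syz D \<equiv> syzygy_trunc first_var other_vars (monomials_of_maps u X) D"

lemma cong_refl: "cong_mod (syz D) s s"
  unfolding diff_self by (rule syzygy_trunc_zero)

lemma cong_sym: "cong_mod (syz D) s t \<Longrightarrow> cong_mod (syz D) t s"
  by (drule syzygy_trunc_uminus) simp

lemma cong_trans: "cong_mod (syz D) s t \<Longrightarrow> cong_mod (syz D) t v \<Longrightarrow> cong_mod (syz D) s v"
  by (drule (1) syzygy_trunc_add) simp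

text \<open>The variables of the cofactor \<open>A\<close> are moved to first position one by one.
  \<open>B\<close> holds the variable that is set aside while the induction hypothesis treats the
  others.\<close>

lemma cong_first_var:
  assumes a: "a \<in> lattice_points u CARD('d)" and "total_degree (A + B) + CARD('d) \<le> D"
  shows "cong_mod (syz D) (A + B + m_exp X a) (push first_var A + B + m_exp X a)"
  using assms(2)
proof (induction A arbitrary: B rule: exponent_induct)
  case zero
  show ?case
    by (simp add: syzygy_trunc_zero)
next
  case (eps v A)
  let ?s = "push first_var A + B + m_exp X a"
  have "cong_mod (syz D) (A + (eps v + B) + m_exp X a) (push first_var A + (eps v + B) + m_exp X a)"
    using eps.prems by (intro eps.IH) (simp add: total_degree_add)
  moreover have "cong_mod (syz D) (eps v + ?s) (eps (first_var v) + ?s)"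
  proof (cases "v \<in> other_vars")
    case True
    have "?s \<in> monomials_of_maps u X"
      using a by blast
    \<comment> \<open>The cofactor of the difference lacks the variable \<open>v\<close>, so the
      weak bound on the whole monomial becomes the strict bound required of cofactors.\<close>
    moreover have "total_degree ?s < D"
      using eps.prems by (simp add: total_degree_add total_degree_push total_degree_m_exp[OF a])
    ultimately have "binomial_diff first_var v * monomial ?s \<in>
        (syzygy_trunc first_var other_vars (monomials_of_maps u X) D :: ('n \<times> 'd, 'k) mpoly set)"
      using True by (intro syzygy_trunc_binomial_diff) (auto simp: monomial_trunc_def monomial_def)
    then have "cong_mod (syz D) (eps (first_var v) + ?s) (eps v + ?s)"
      by (simp add: binomial_diff_def var_def monomial_def left_diff_distrib mult_single)
    then show ?thesis
      by (rule cong_sym)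
  next
    case False
    then have "first_var v = v"
      by (metis (mono_tags) mem_Collect_eq prod.collapse)
    then show ?thesis
      by (simp only: cong_refl)
  qed
  ultimately show ?case
    using cong_trans by (simp add: push_add ac_simps)
qed

text \<open>Cofactors with equal image have the same form in the first variables, to which both are
  congruent.\<close>

lemma cong_same_point:
  assumes "a \<in> lattice_points u CARD('d)" "push fst A + a = w" "push fst B + a = w" "total_degree w \<le> D"
  shows "cong_mod (syz D) (A + m_exp X a) (B + m_exp X a)"
proof -
  have "push fst A = push fst B"
    using assms(2,3) by (metis add_right_cancel)
  moreover have "total_degree A + CARD('d) \<le> D"
    using assms by (auto simp: lattice_points_def total_degree_add total_degree_push)
  ultimately have "cong_mod (syz D) (A + m_exp X a) (push first_var A + m_exp X a)"
      "cong_mod (syz D) (B + m_exp X a) (push first_var A + m_exp X a)"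
    using cong_first_var[OF assms(1), of A 0 D] cong_first_var[OF assms(1), of B 0 D]
      push_first_var_eq_iff[of A B] total_degree_push[of fst A] total_degree_push[of fst B] by simp_all
  then show ?thesis
    using cong_trans cong_sym by blast
qed

text \<open>The two generators have a common multiple, obtained by adding \<open>eps (i, s)\<close>
  to one and \<open>eps (j, r)\<close> to the other. Both given multiples are moved to it, times a
  lift of the surplus \<open>w\<close> over \<open>c\<close>.\<close>

lemma cong_edge:
  assumes c: "c \<in> lattice_points u (CARD('d) + 1)" and edge: "linear_syzygy_edge X c i j"
    and A: "push fst A + (c - eps i) = w + c" and B: "push fst B + (c - eps j) = w + c"
    and D: "total_degree (w + c) \<le> D"
  shows "cong_mod (syz D) (A + m_exp X (c - eps i)) (B + m_exp X (c - eps j))"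
proof -
  obtain t r s where t: "m_exp X (c - eps i) = eps (j, r) + t" "m_exp X (c - eps j) = eps (i, s) + t"
    and ij: "i \<in> Poly_Mapping.keys c" "j \<in> Poly_Mapping.keys c"
    using edge unfolding linear_syzygy_edge_def by blast
  have "push fst (at_first w + eps (i, s)) + (c - eps i) = w + c"
    using eps_add_minus[OF ij(1)] by (simp add: push_add add.assoc)
  with c ij A D have 1: "cong_mod (syz D) (A + m_exp X (c - eps i)) (at_first w + eps (i, s) + m_exp X (c - eps i))"
    by (intro cong_same_point lattice_points_minus_eps)
  have "push fst (at_first w + eps (j, r)) + (c - eps j) = w + c"
    using eps_add_minus[OF ij(2)] by (simp add: push_add add.assoc)
  with c ij B D have 2: "cong_mod (syz D) (at_first w + eps (j, r) + m_exp X (c - eps j)) (B + m_exp X (c - eps j))"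
    by (intro cong_same_point[where w = "w + c"] lattice_points_minus_eps)
  have 3: "at_first w + eps (i, s) + m_exp X (c - eps i) = at_first w + eps (j, r) + m_exp X (c - eps j)"
    by (simp add: t ac_simps)
  show ?thesis
    using 1[unfolded 3] 2 by (rule cong_trans)
qed

lemma cong_down_graph:
  assumes c: "c \<in> lattice_points u (CARD('d) + 1)" and i: "i \<in> Poly_Mapping.keys c"
    and path: "(i, j) \<in> (edge_rel X c)\<^sup>*"
    and A: "push fst A + (c - eps i) = w + c" and B: "push fst B + (c - eps j) = w + c"
    and D: "total_degree (w + c) \<le> D"
  shows "cong_mod (syz D) (A + m_exp X (c - eps i)) (B + m_exp X (c - eps j))"
  using path B
proof (induction arbitrary: B rule: rtrancl_induct)
  case base
  with c i A D show ?case
    by (intro cong_same_point lattice_points_minus_eps)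
next
  case (step k l)
  then have edge: "linear_syzygy_edge X c k l"
    by simp
  then have "k \<in> Poly_Mapping.keys c"
    by (simp add: linear_syzygy_edge_def)
  then have C: "push fst (at_first (w + eps k)) + (c - eps k) = w + c"
    using eps_add_minus[of k c] by (simp only: push_fst_at_first add.assoc)
  show ?case
    using step.IH[OF C] cong_edge[OF c edge C step.prems D] by (rule cong_trans)
qed

text \<open>Generation of the syzygies by linear ones, in congruence form. Since subtraction on
  \<open>nat\<close> is truncated, the measure is the sum of the positive parts of a - b; each step
  moves one unit of \<open>a\<close> from a coordinate that exceeds \<open>b\<close> to one that
  falls short, inside a single down-graph.\<close>

lemma cong_lattice_points:
  assumes connected: "\<And>c i j. c \<in> lattice_points u (CARD('d) + 1) \<Longrightarrow> i \<in> Poly_Mapping.keys c \<Longrightarrow>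
      j \<in> Poly_Mapping.keys c \<Longrightarrow> (i, j) \<in> (edge_rel X c)\<^sup>*"
    and "a \<in> lattice_points u CARD('d)" "b \<in> lattice_points u CARD('d)"
    and "push fst A + a = w" "push fst B + b = w" "total_degree w \<le> D"
  shows "cong_mod (syz D) (A + m_exp X a) (B + m_exp X b)"
  using assms(2,4)
proof (induction "\<Sum>i\<in>UNIV. Poly_Mapping.lookup a i - Poly_Mapping.lookup b i" arbitrary: a A rule: less_induct)
  case (less a A)
  show ?case
  proof (cases "a = b")
    case True
    then show ?thesis
      using cong_same_point[OF less.prems(1,2) _ assms(6), of B] assms(5) by simp
  next
    case False
    have sum: "(\<Sum>i\<in>UNIV. Poly_Mapping.lookup a i) = (\<Sum>i\<in>UNIV. Poly_Mapping.lookup b i)"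
      using less.prems(1) assms(3) by (simp add: lattice_points_def total_degree_def)
    obtain k where "Poly_Mapping.lookup a k \<noteq> Poly_Mapping.lookup b k"
      using False by (metis poly_mapping_eqI)
    have "\<exists>j. Poly_Mapping.lookup a j < Poly_Mapping.lookup b j"
      by (rule ccontr) (use sum \<open>Poly_Mapping.lookup a k \<noteq> _\<close> sum_mono_inv[of "Poly_Mapping.lookup b" UNIV "Poly_Mapping.lookup a" k] in \<open>auto simp: not_less\<close>)
    then obtain j where j: "Poly_Mapping.lookup a j < Poly_Mapping.lookup b j"
      by blast
    have "\<exists>i. Poly_Mapping.lookup b i < Poly_Mapping.lookup a i"
      by (rule ccontr) (use sum \<open>Poly_Mapping.lookup a k \<noteq> _\<close> sum_mono_inv[of "Poly_Mapping.lookup a" UNIV "Poly_Mapping.lookup b" k] in \<open>auto simp: not_less\<close>)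
    then obtain i where i: "Poly_Mapping.lookup b i < Poly_Mapping.lookup a i"
      by blast
    \<comment> \<open>Both \<open>a\<close> and the next point \<open>c - eps i\<close> are vertices
      below this \<open>c\<close>, which respects the bound \<open>u\<close> because coordinate
      \<open>j\<close> does not exceed that of \<open>b\<close>.\<close>
    define c where "c = eps j + a"
    have "Poly_Mapping.lookup a l \<le> u l" "Poly_Mapping.lookup b l \<le> u l" for l
      using less.prems(1) assms(3) by (simp_all add: lattice_points_def)
    from this(1) this(2)[of j] j have "Poly_Mapping.lookup c l \<le> u l" for l
      by (cases "j = l") (simp_all add: c_def lookup_add lookup_single)
    with less.prems(1) have c: "c \<in> lattice_points u (CARD('d) + 1)"
      by (simp add: lattice_points_def c_def total_degree_add)
    have keys: "i \<in> Poly_Mapping.keys c" "j \<in> Poly_Mapping.keys c"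
      using i j by (auto simp: c_def in_keys_iff lookup_add)
    have a: "c - eps j = a"
      by (simp add: c_def)
    \<comment> \<open>Truncated subtraction is exact here: \<open>w\<close> dominates both
      \<open>a\<close> and \<open>b\<close>, hence also \<open>c\<close>.\<close>
    have w: "w - c + c = w"
    proof (rule poly_mapping_eqI)
      fix l
      have "Poly_Mapping.lookup c l \<le> Poly_Mapping.lookup w l"
        using j arg_cong[OF less.prems(2), of "\<lambda>x. Poly_Mapping.lookup x l"]
          arg_cong[OF assms(5), of "\<lambda>x. Poly_Mapping.lookup x l"]
        by (auto simp: c_def lookup_add lookup_single when_def)
      then show "Poly_Mapping.lookup (w - c + c) l = Poly_Mapping.lookup w l"
        by (simp add: lookup_add lookup_minus)
    qed
    have A': "push fst (at_first (w - c + eps i)) + (c - eps i) = w"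
      using w eps_add_minus[OF keys(1)] by (simp only: push_fst_at_first add.assoc)
    have "cong_mod (syz D) (A + m_exp X a) (at_first (w - c + eps i) + m_exp X (c - eps i))"
      using cong_down_graph[OF c keys(2) connected[OF c keys(2,1)], of A "w - c" "at_first (w - c + eps i)" D]
        less.prems(2) A' w assms(6) unfolding a by simp
    moreover have "cong_mod (syz D) (at_first (w - c + eps i) + m_exp X (c - eps i)) (B + m_exp X b)"
    proof (rule less.hyps)
      have le: "Poly_Mapping.lookup (c - eps i) l - Poly_Mapping.lookup b l \<le> Poly_Mapping.lookup a l - Poly_Mapping.lookup b l" for l
        using i j by (auto simp: c_def lookup_add lookup_minus lookup_single when_def)
      have "i \<noteq> j"
        using i j by auto
      then have "Poly_Mapping.lookup (c - eps i) i - Poly_Mapping.lookup b i < Poly_Mapping.lookup a i - Poly_Mapping.lookup b i"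
        using i by (simp add: c_def lookup_add lookup_minus lookup_single when_def)
      with le show "(\<Sum>l\<in>UNIV. Poly_Mapping.lookup (c - eps i) l - Poly_Mapping.lookup b l)
          < (\<Sum>l\<in>UNIV. Poly_Mapping.lookup a l - Poly_Mapping.lookup b l)"
        by (intro sum_strict_mono_ex1) auto
    qed (use A' lattice_points_minus_eps[OF c keys(1)] in auto)
    ultimately show ?thesis
      by (rule cong_trans)
  qed
qed

section \<open>The image of J, and properness\<close>

lemma depolarize_ideal_of_maps:
  "depolarize ` (ideal_of_maps u X :: ('n \<times> 'd, 'k) mpoly set) = restricted_power CARD('d) u"
proof
  let ?J = "ideal_of_maps u X :: ('n \<times> 'd, 'k) mpoly set"
  let ?I = "restricted_power CARD('d) u :: ('n, 'k) mpoly set"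
  have mult: "depolarize (p * q) = depolarize p * depolarize q"
    and add: "depolarize (p + q) = depolarize p + depolarize q" for p q :: "('n \<times> 'd, 'k) mpoly"
    by (simp_all add: depolarize_eq_push push_add push_mult)
  have gen: "depolarize (monomial (m_exp X a) :: ('n \<times> 'd, 'k) mpoly) = monomial a"
    if "a \<in> lattice_points u CARD('d)" for a
    using that by (simp add: depolarize_eq_push monomial_def push_fst_m_exp)
  have "ring_module.subspace {p :: ('n \<times> 'd, 'k) mpoly. depolarize p \<in> ?I}"
    by (rule ring_module.subspaceI)
      (auto simp: restricted_power_def ideal_gen_def mult add depolarize_eq_push[of 0]
        intro: ring_module.span_zero ring_module.span_add ring_module.span_scale)
  moreover have "(\<lambda>a. monomial (m_exp X a)) ` lattice_points u CARD('d) \<subseteq> {p :: ('n \<times> 'd, 'k) mpoly. depolarize p \<in> ?I}"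
    by (auto simp: gen restricted_power_def ideal_gen_def intro: ring_module.span_base)
  ultimately show "depolarize ` ?J \<subseteq> ?I"
    unfolding ideal_of_maps_def ideal_gen_def using ring_module.span_minimal by blast
  have "ring_module.subspace (depolarize ` ?J)"
  proof (rule ring_module.subspaceI)
    show "0 \<in> depolarize ` ?J"
      by (rule image_eqI[of _ _ 0])
        (simp_all add: depolarize_eq_push ideal_of_maps_def ideal_gen_def ring_module.span_zero)
    fix x y
    assume "x \<in> depolarize ` ?J" "y \<in> depolarize ` ?J"
    then show "x + y \<in> depolarize ` ?J"
      by (auto simp: ideal_of_maps_def ideal_gen_def simp flip: add intro: ring_module.span_add)
  next
    fix r x
    assume "x \<in> depolarize ` ?J"
    \<comment> \<open>The image of an ideal is an ideal only because the homomorphism is surjective;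
      \<open>at_first\<close> provides the preimage.\<close>
    moreover have "r = depolarize (push at_first r :: ('n \<times> 'd, 'k) mpoly)"
      by (simp add: depolarize_eq_push push_push)
    ultimately show "r * x \<in> depolarize ` ?J"
      by (metis (no_types, lifting) ideal_gen_def ideal_of_maps_def imageE image_eqI mult ring_module.span_scale)
  qed
  moreover have "monomial ` lattice_points u CARD('d) \<subseteq> depolarize ` ?J"
    by (auto simp: ideal_of_maps_def ideal_gen_def simp flip: gen intro: ring_module.span_base)
  ultimately show "?I \<subseteq> depolarize ` ?J"
    unfolding restricted_power_def ideal_gen_def[of "monomial ` _"] by (rule ring_module.span_minimal[rotated])
qed

text \<open>No element of this ideal has a constant term: the generators m(a) have degree d, which
  is at least 1, and the differences are linear forms.\<close>

lemma ideal_gen_ideal_of_maps_sigma_proper: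
  "ideal_gen (ideal_of_maps u X \<union> set sigma) \<noteq> (UNIV :: ('n \<times> 'd, 'k) mpoly set)"
proof
  let ?N = "{p :: ('n \<times> 'd, 'k) mpoly. 0 \<notin> Poly_Mapping.keys p}"
  have zero_sum: "b = 0" if "0 = a + b" for a b :: "'n \<times> 'd \<Rightarrow>\<^sub>0 nat"
    using that by (metis add_is_0 total_degree_add total_degree_eq_0_iff)
  have "ring_module.subspace ?N"
  proof (rule ring_module.subspaceI)
    fix c x
    assume "x \<in> ?N"
    then show "c * x \<in> ?N"
      by (auto dest!: subsetD[OF keys_mult] dest: zero_sum)
  qed (auto dest!: subsetD[OF keys_add])
  moreover have "m_exp X a \<noteq> 0" if "a \<in> lattice_points u CARD('d)" for a
    using total_degree_m_exp[OF that] by auto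
  then have "0 \<notin> monomials_of_maps u X"
    by (auto dest: zero_sum[OF sym])
  then have "ideal_of_maps u X \<subseteq> ?N"
    unfolding ideal_of_maps_eq subset_iff[of "ideal_gen _"] in_ideal_gen_monomials_iff by blast
  moreover have "set sigma \<subseteq> ?N"
  proof -
    have "binomial_diff first_var v \<in> ?N" for v
      using keys_diff[of "var (first_var v)" "var v :: ('n \<times> 'd, 'k) mpoly"]
      by (auto simp: binomial_diff_def var_def monomial_def simp flip: total_degree_eq_0_iff)
    then show ?thesis
      by (auto simp: set_sigma)
  qed
  ultimately have "ideal_gen (ideal_of_maps u X \<union> set sigma) \<subseteq> ?N"
    unfolding ideal_gen_def by (intro ring_module.span_minimal) auto
  moreover have "1 \<notin> ?N"
    by simp
  moreover assume "ideal_gen (ideal_of_maps u X \<union> set sigma) = (UNIV :: ('n \<times> 'd, 'k) mpoly set)"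
  ultimately show False
    by blast
qed

section \<open>Connectedness of the down-graphs versus polarization\<close>

lemma polarization_of_if_connected:
  assumes connected: "\<And>c i j. c \<in> lattice_points u (CARD('d) + 1) \<Longrightarrow> i \<in> Poly_Mapping.keys c \<Longrightarrow>
      j \<in> Poly_Mapping.keys c \<Longrightarrow> (i, j) \<in> (edge_rel X c)\<^sup>*"
  shows "polarization_of (ideal_of_maps u X :: ('n \<times> 'd, 'k) mpoly set) (restricted_power CARD('d) u)"
proof -
  let ?J = "ideal_of_maps u X :: ('n \<times> 'd, 'k) mpoly set"
  obtain vs :: "('n \<times> 'd) list" where vs: "(sigma :: ('n \<times> 'd, 'k) mpoly list) = map (binomial_diff first_var) vs"
    "distinct vs" "set vs = other_vars"
    by (rule sigma_eq_map)
  have "p \<in> ideal_gen (?J \<union> set (take m sigma))"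
    if m: "m < length (sigma :: ('n \<times> 'd, 'k) mpoly list)" and p: "sigma ! m * p \<in> ideal_gen (?J \<union> set (take m sigma))" for m p
  proof -
    have take: "set (take m (sigma :: ('n \<times> 'd, 'k) mpoly list)) = binomial_diff first_var ` set (take m vs)"
      by (simp add: vs take_map)
    have m': "m < length vs"
      using m by (simp add: vs)
    show ?thesis
      unfolding take ideal_of_maps_eq
    proof (rule binomial_diff_regular_mod_monomials[of other_vars])
      show "binomial_diff first_var (vs ! m) * p \<in> ideal_gen
          (ideal_gen (monomial ` m_exp X ` lattice_points u CARD('d)) \<union> binomial_diff first_var ` set (take m vs))"
        using p m' unfolding take ideal_of_maps_eq by (simp add: vs)
      show "insert (vs ! m) (set (take m vs)) \<subseteq> other_vars"
        using m' nth_mem[OF m'] set_take_subset[of m vs] vs(3) by blast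
      show "vs ! m \<notin> set (take m vs)"
        using vs(2) m' by (auto simp: in_set_conv_nth nth_eq_iff_index_eq)
    next
      fix s t D
      assume s: "s \<in> monomials_of_maps u X" and t: "t \<in> monomials_of_maps u X" and D: "total_degree s \<le> D"
        and eq: "push (collapse first_var other_vars) s = push (collapse first_var other_vars) t"
      from s t obtain A B a b where st: "s = A + m_exp X a" "t = B + m_exp X b"
        and ab: "a \<in> lattice_points u CARD('d)" "b \<in> lattice_points u CARD('d)"
        by blast
      have "push fst A + a = push fst s"
        by (simp add: st(1) push_add push_fst_m_exp[OF ab(1)])
      moreover have "push fst B + b = push fst s"
        using eq push_first_var_eq_iff[of s t]
        by (simp add: st(2) push_add push_fst_m_exp[OF ab(2)])
      ultimately show "monomial s - monomial t \<in>
          (syzygy_trunc first_var other_vars (monomials_of_maps u X) D :: ('n \<times> 'd, 'k) mpoly set)"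
        unfolding st using connected ab D
        by (intro cong_lattice_points[where w = "push fst s"]) (simp_all add: total_degree_push st)
    qed simp
  qed
  moreover have "ring_module.subspace ?J"
    by (simp add: ideal_of_maps_def ideal_gen_def)
  ultimately show ?thesis
    unfolding polarization_of_def regular_sequence_mod_def
    using ideal_gen_ideal_of_maps_sigma_proper depolarize_ideal_of_maps by blast
qed

lemma connected_if_polarization_of:
  assumes pol: "polarization_of (ideal_of_maps u X :: ('n \<times> 'd, 'k) mpoly set) (restricted_power CARD('d) u)"
    and c: "c \<in> lattice_points u (CARD('d) + 1)"
    and ij: "i \<in> Poly_Mapping.keys c" "j \<in> Poly_Mapping.keys c"
  shows "(i, j) \<in> (edge_rel X c)\<^sup>*"
proof -
  let ?J = "ideal_of_maps u X :: ('n \<times> 'd, 'k) mpoly set"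
  \<comment> \<open>\<open>C\<close> is the component of \<open>i\<close>, and \<open>G\<close>
    collects the multiples lying over it, with every second index \<open>r\<close>, so that trading
    \<open>x_ij\<close> for \<open>x_i1\<close> cannot leave \<open>G\<close>.\<close>
  define C where "C = {l \<in> Poly_Mapping.keys c. (i, l) \<in> (edge_rel X c)\<^sup>*}"
  define G where "G = {eps (l, r) + m_exp X (c - eps l) | l r. l \<in> C}"
  define \<phi> :: "('n \<times> 'd, 'k) mpoly \<Rightarrow> 'k"
    where "\<phi> f = (\<Sum>t\<in>Poly_Mapping.keys f. Poly_Mapping.lookup f t when t \<in> G)" for f
  have G_iff: "eps (l, r) + m_exp X (c - eps l) \<in> G \<longleftrightarrow> l \<in> C" if l: "l \<in> Poly_Mapping.keys c" for l r
  proof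
    assume "eps (l, r) + m_exp X (c - eps l) \<in> G"
    then obtain l' r' where l': "l' \<in> C"
      and eq: "eps (l, r) + m_exp X (c - eps l) = eps (l', r') + m_exp X (c - eps l')"
      unfolding G_def by blast
    then have "l' = l \<or> linear_syzygy_edge X c l' l"
      using linear_syzygy_edgeI[OF c _ l _ eq[symmetric]] by (auto simp: C_def)
    with l' l show "l \<in> C"
      unfolding C_def by (auto intro: rtrancl_into_rtrancl)
  qed (auto simp: G_def)
  have \<phi>_add: "\<phi> (f + g) = \<phi> f + \<phi> g" for f g
    unfolding \<phi>_def by (rule setsum_keys_plus_distrib) (simp_all add: when_add_distrib)
  have \<phi>_diff: "\<phi> (f - g) = \<phi> f - \<phi> g" for f g
    using \<phi>_add[of "f - g" g] by simp
  have \<phi>_single: "\<phi> (Poly_Mapping.single t k) = (k when t \<in> G)" for t k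
    by (simp add: \<phi>_def)
  have zero: "\<phi> (f * r) = 0" if r: "r \<in> set sigma" and f: "f \<in> ?J" for r f
  proof -
    obtain v where r: "r = binomial_diff first_var v"
      using r unfolding set_sigma by blast
    have "\<phi> (Poly_Mapping.single t k * r) = 0" if "t \<in> monomials_of_maps u X" for t k
    proof -
      obtain A a where t: "t = A + m_exp X a" and a: "a \<in> lattice_points u CARD('d)"
        using \<open>t \<in> monomials_of_maps u X\<close> by blast
      \<comment> \<open>Monomials in \<open>G\<close> have degree d + 1, so \<open>t\<close> must be
        a generator with \<open>A = 0\<close>, namely the one at \<open>c - eps (fst v)\<close>. By
        \<open>G_iff\<close>, membership then depends on \<open>fst v\<close> alone.\<close>
      have "eps (fst v, q') + t \<in> G" if "eps (fst v, q) + t \<in> G" for q q'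
      proof -
        from that obtain l r where l: "l \<in> C" and eq: "eps (fst v, q) + t = eps (l, r) + m_exp X (c - eps l)"
          unfolding G_def by blast
        have keys: "l \<in> Poly_Mapping.keys c"
          using l by (simp add: C_def)
        have "push fst (eps (fst v, q) + t) = c"
          unfolding eq using eps_add_minus[OF keys] push_fst_m_exp[OF lattice_points_minus_eps[OF c keys]]
          by (simp add: push_add)
        then have sum: "eps (fst v) + (push fst A + a) = c"
          by (simp add: t push_add push_fst_m_exp[OF a])
        then have "total_degree (eps (fst v) + (push fst A + a)) = CARD('d) + 1"
          using c by (simp add: lattice_points_def)
        then have "total_degree A = 0"
          using a by (simp add: total_degree_add total_degree_push lattice_points_def)
        then have "A = 0"
          by (simp add: total_degree_eq_0_iff)
        with sum have v: "fst v \<in> Poly_Mapping.keys c" and "a = c - eps (fst v)"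
          using eps_in_keys_add by auto
        with t \<open>A = 0\<close> have "t = m_exp X (c - eps (fst v))"
          by simp
        with that show ?thesis
          using G_iff[OF v] by simp
      qed
      then have "eps (first_var v) + t \<in> G \<longleftrightarrow> eps v + t \<in> G"
        by (metis prod.collapse)
      then show ?thesis
        by (simp add: r binomial_diff_def var_def monomial_def right_diff_distrib mult_single
            \<phi>_diff \<phi>_single add.commute)
    qed
    moreover have "\<phi> ((\<Sum>t\<in>S. p t) * r) = (\<Sum>t\<in>S. \<phi> (p t * r))" for S and p :: "('n \<times> 'd \<Rightarrow>\<^sub>0 nat) \<Rightarrow> ('n \<times> 'd, 'k) mpoly"
      by (induction S rule: infinite_finite_induct) (simp_all add: distrib_right \<phi>_add, simp_all add: \<phi>_def)
    ultimately have "\<phi> ((\<Sum>t\<in>Poly_Mapping.keys f. Poly_Mapping.single t (Poly_Mapping.lookup f t)) * r) = 0"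
      using f unfolding ideal_of_maps_eq in_ideal_gen_monomials_iff by (simp add: subset_iff)
    then show ?thesis
      by (simp flip: poly_mapping_sum_singles)
  qed
  \<comment> \<open>Both monomials are lifts of the monomial with exponent \<open>c\<close>, so
    \<open>f\<close> lies in J and in the ideal of \<open>sigma\<close>; the functional takes the
    value 1 on it if \<open>j\<close> is outside \<open>C\<close>, and 0 otherwise.\<close>
  define f where "f = (monomial (eps (i, Min UNIV) + m_exp X (c - eps i))
    - monomial (eps (j, Min UNIV) + m_exp X (c - eps j)) :: ('n \<times> 'd, 'k) mpoly)"
  have sub: "ring_module.subspace ?J" and regular: "regular_sequence_mod ?J sigma"
    using pol by (simp_all add: polarization_of_def)
  have "f \<in> ?J"
    unfolding f_def using sub
    by (rule ring_module.subspace_diff) (intro monomial_in_ideal_of_maps lattice_points_minus_eps[OF c] ij)+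
  moreover have "push fst (eps (l, Min UNIV) + m_exp X (c - eps l)) = c" if "l \<in> Poly_Mapping.keys c" for l
    using eps_add_minus[OF that] push_fst_m_exp[OF lattice_points_minus_eps[OF c that]]
    by (simp add: push_add)
  then have "f \<in> ideal_gen (set sigma)"
    unfolding in_ideal_gen_sigma_iff f_def using ij
    by (simp add: push_diff monomial_def push_first_var)
  ultimately have "\<phi> f = 0"
    using regular_sequence_mod_functional[OF regular sub \<phi>_add zero] by blast
  moreover have "i \<in> C"
    using ij by (simp add: C_def)
  ultimately have "j \<in> C"
    using G_iff ij by (simp add: f_def \<phi>_diff monomial_def \<phi>_single when_def split: if_splits)
  then show ?thesis
    by (simp add: C_def)
qed

end

section \<open>Linear syzygy edges and the Schur module\<close>

text \<open>The basis element attached to the vertex \<open>c - eps i\<close>; over the support of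
  \<open>c\<close> these form a basis of the part of multidegree \<open>c\<close>.\<close>

abbreviation vertex_elt :: "('n \<Rightarrow>\<^sub>0 nat) \<Rightarrow> 'n \<Rightarrow> 'n set \<times> ('n \<Rightarrow>\<^sub>0 nat)" where
  "vertex_elt c i \<equiv> ({i}, c - eps i)"

lemma multidegree_vertex_elt: "i \<in> Poly_Mapping.keys c \<Longrightarrow> multidegree (vertex_elt c i) = c"
  using eps_add_minus[of i c] by (simp add: multidegree_def add.commute)

lemma kappa_single:
  "kappa (Poly_Mapping.single b r) = scale r (kappa_basis b)"
  by (auto simp: kappa_def lookup_scale intro: poly_mapping_eqI)

lemma kappa_add: "kappa (x + y) = kappa x + kappa y"
  unfolding kappa_def
  by (rule setsum_keys_plus_distrib)
    (auto intro: poly_mapping_eqI simp: lookup_scale lookup_add distrib_right)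

lemma scale_single: "scale r (Poly_Mapping.single b s) = Poly_Mapping.single b (r * s)"
  by (rule poly_mapping_eqI) (simp add: lookup_scale lookup_single when_def)

interpretation scale_module: module "scale :: 'r::comm_ring_1 \<Rightarrow> ('b \<Rightarrow>\<^sub>0 'r) \<Rightarrow> _"
  by (rule module_scale)

lemma kappa_scale: "kappa (scale r x) = scale r (kappa x)"
  by (induction x rule: poly_mapping_add_induct)
    (simp_all add: scale_module.scale_right_distrib kappa_add scale_single kappa_single, simp add: kappa_def)

text \<open>With a single wedge factor the sign is trivial, and only the multidegree survives. The
  kernel thus consists of the elements with coefficient sum zero in each multidegree.\<close>

lemma kappa_singleton_part:
  fixes x :: "('n::{finite,linorder}, 'r::comm_ring_1) wedge_sym"
  assumes "x \<in> wedge_sym_part 1 d"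
  shows "kappa x = push (\<lambda>z. ({}, multidegree z)) x"
proof -
  have "kappa_basis z = (Poly_Mapping.single ({}, multidegree z) 1 :: ('n, 'r) wedge_sym)"
    if z: "z \<in> Poly_Mapping.keys x" for z
  proof -
    obtain J \<alpha> where "z = (J, \<alpha>)"
      by (cases z)
    with z assms have "card J = 1"
      by (auto simp: wedge_sym_part_def)
    then obtain j where "J = {j}"
      by (rule card_1_singletonE)
    then show ?thesis
      using \<open>z = (J, \<alpha>)\<close> by (simp add: kappa_basis_def multidegree_def Collect_conv_if)
  qed
  then show ?thesis
    unfolding kappa_def push_def by (intro sum.cong) (simp_all add: scale_single)
qed

text \<open>Removing the smaller index \<open>i\<close> moves it past \<open>j\<close>, hence the
  minus sign at the vertex of \<open>j\<close>.\<close>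

lemma kappa_tab_element:
  assumes i: "i \<in> Poly_Mapping.keys c" and j: "j \<in> Poly_Mapping.keys c" and "i < j"
  shows "kappa (Poly_Mapping.single ({i, j}, c - eps i - eps j) 1) =
    (Poly_Mapping.single (vertex_elt c i) 1 - Poly_Mapping.single (vertex_elt c j) 1
      :: ('n::{finite,linorder}, 'r::comm_ring_1) wedge_sym)"
proof -
  \<comment> \<open>As \<open>i\<close> and \<open>j\<close> differ, each is still in the support
    after the other is subtracted, so adding it back is exact.\<close>
  have "Poly_Mapping.keys (c - eps i) \<inter> {j} = {j}" "Poly_Mapping.keys (c - eps j) \<inter> {i} = {i}"
    using assms by (auto simp: in_keys_iff lookup_minus lookup_single)
  then have "c - eps i - eps j + eps j = c - eps i" "c - eps j - eps i + eps i = c - eps j"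
    using eps_add_minus[of j "c - eps i"] eps_add_minus[of i "c - eps j"] by (auto simp: add.commute)
  moreover have "c - eps i - eps j = c - eps j - eps i"
    by (rule poly_mapping_eqI) (simp add: lookup_minus)
  moreover have sets: "{l. (l = i \<or> l = j) \<and> i < l} = {j}" "{l. (l = i \<or> l = j) \<and> j < l} = {}"
      "{i, j} - {i} = {j}" "{i, j} - {j} = {i}"
    using \<open>i < j\<close> by auto
  moreover have "i \<noteq> j"
    using \<open>i < j\<close> by simp
  ultimately show ?thesis
    by (simp add: kappa_single kappa_basis_def single_uminus sets)
qed

lemma vertex_diff_in_schur_module_le:
  assumes c: "c \<in> lattice_points u (d + 1)" and ij: "i \<in> Poly_Mapping.keys c" "j \<in> Poly_Mapping.keys c"
  shows "Poly_Mapping.single (vertex_elt c i) 1 - Poly_Mapping.single (vertex_elt c j) 1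
    \<in> (schur_module_le u 1 d :: ('n::{finite,linorder}, 'r::comm_ring_1) wedge_sym set)"
proof -
  let ?x = "Poly_Mapping.single (vertex_elt c i) 1 - Poly_Mapping.single (vertex_elt c j) 1 :: ('n, 'r) wedge_sym"
  have "\<exists>l\<in>Poly_Mapping.keys c. z = vertex_elt c l" if "z \<in> Poly_Mapping.keys ?x" for z
    using subsetD[OF keys_diff that] ij by auto
  moreover have "total_degree (c - eps l) = d" if "l \<in> Poly_Mapping.keys c" for l
    using lattice_points_minus_eps[OF c that] by (simp add: lattice_points_def)
  ultimately have part: "?x \<in> wedge_sym_part 1 d"
    and le: "\<forall>z\<in>Poly_Mapping.keys ?x. \<forall>i. Poly_Mapping.lookup (multidegree z) i \<le> u i"
    using c by (fastforce simp: wedge_sym_part_def multidegree_vertex_elt lattice_points_def)+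
  have "kappa ?x = 0"
    unfolding kappa_singleton_part[OF part] push_diff push_single by (simp add: multidegree_vertex_elt ij)
  with part le show ?thesis
    by (simp add: schur_module_le_def schur_module_def)
qed

lemma subspace_schur_module_le:
  "scale_module.subspace (schur_module_le u a b :: ('n::{finite,linorder}, 'r::comm_ring_1) wedge_sym set)"
proof (rule scale_module.subspaceI)
  fix r and x :: "('n, 'r) wedge_sym"
  assume "x \<in> schur_module_le u a b"
  moreover have "Poly_Mapping.keys (scale r x) \<subseteq> Poly_Mapping.keys x"
    by (auto simp: in_keys_iff lookup_scale)
  ultimately show "scale r x \<in> schur_module_le u a b"
    by (fastforce simp: schur_module_le_def schur_module_def wedge_sym_part_def kappa_scale)
next
  fix x y :: "('n, 'r) wedge_sym"
  assume "x \<in> schur_module_le u a b" "y \<in> schur_module_le u a b"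
  then show "x + y \<in> schur_module_le u a b"
    using keys_add[of x y] by (fastforce simp: schur_module_le_def schur_module_def wedge_sym_part_def kappa_add)
qed (simp add: schur_module_le_def schur_module_def wedge_sym_part_def kappa_def)

lemma span_tab_subset:
  fixes X :: "'n::{finite,linorder} \<Rightarrow> ('n \<Rightarrow>\<^sub>0 nat) \<Rightarrow> 'd::finite set"
  shows "scale_module.span (kappa ` tab u X) \<subseteq>
    (schur_module_le u 1 CARD('d) :: ('n, 'r::comm_ring_1) wedge_sym set)"
proof (rule scale_module.span_minimal[OF _ subspace_schur_module_le])
  show "kappa ` tab u X \<subseteq> (schur_module_le u 1 CARD('d) :: ('n, 'r) wedge_sym set)"
  proof clarify
    fix x :: "('n, 'r) wedge_sym"
    assume "x \<in> tab u X"
    then obtain c i j where x: "x = Poly_Mapping.single ({i, j}, c - eps i - eps j) 1"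
      and c: "c \<in> lattice_points u (CARD('d) + 1)" and "i < j" "linear_syzygy_edge X c i j"
      unfolding tab_def by blast
    then have ij: "i \<in> Poly_Mapping.keys c" "j \<in> Poly_Mapping.keys c"
      by (auto simp: linear_syzygy_edge_def)
    then show "kappa x \<in> schur_module_le u 1 CARD('d)"
      unfolding x kappa_tab_element[OF ij \<open>i < j\<close>] by (intro vertex_diff_in_schur_module_le c)
  qed
qed

text \<open>The tableaux only list pairs with the smaller index in front; the other orientation is
  the negative.\<close>

lemma edge_diff_in_span_tab:
  fixes X :: "'n::{finite,linorder} \<Rightarrow> ('n \<Rightarrow>\<^sub>0 nat) \<Rightarrow> 'd::finite set"
  assumes c: "c \<in> lattice_points u (CARD('d) + 1)" and edge: "linear_syzygy_edge X c i j"
  shows "Poly_Mapping.single (vertex_elt c i) 1 - Poly_Mapping.single (vertex_elt c j) 1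
    \<in> scale_module.span (kappa ` (tab u X :: ('n, 'r::comm_ring_1) wedge_sym set))"
proof -
  have *: "Poly_Mapping.single (vertex_elt c k) 1 - Poly_Mapping.single (vertex_elt c l) 1
      \<in> scale_module.span (kappa ` (tab u X :: ('n, 'r) wedge_sym set))"
    if "k < l" "linear_syzygy_edge X c k l" for k l
  proof -
    have kl: "k \<in> Poly_Mapping.keys c" "l \<in> Poly_Mapping.keys c"
      using that(2) by (simp_all add: linear_syzygy_edge_def)
    have "Poly_Mapping.single ({k, l}, c - eps k - eps l) 1 \<in> (tab u X :: ('n, 'r) wedge_sym set)"
      using that c unfolding tab_def by blast
    then have "kappa (Poly_Mapping.single ({k, l}, c - eps k - eps l) 1)
        \<in> scale_module.span (kappa ` (tab u X :: ('n, 'r) wedge_sym set))"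
      by (intro scale_module.span_base imageI)
    then show ?thesis
      unfolding kappa_tab_element[OF kl that(1)] .
  qed
  consider "i < j" | "j < i"
    using edge by (auto simp: linear_syzygy_edge_def neq_iff)
  then show ?thesis
  proof cases
    case 1
    with edge show ?thesis
      by (rule_tac *)
  next
    case 2
    with * linear_syzygy_edge_sym[OF edge] have "- (Poly_Mapping.single (vertex_elt c j) 1 - Poly_Mapping.single (vertex_elt c i) 1)
        \<in> scale_module.span (kappa ` (tab u X :: ('n, 'r) wedge_sym set))"
      by (intro scale_module.span_neg)
    then show ?thesis
      by simp
  qed
qed

lemma span_tab_if_connected:
  fixes X :: "'n::{finite,linorder} \<Rightarrow> ('n \<Rightarrow>\<^sub>0 nat) \<Rightarrow> 'd::finite set"
  assumes connected: "\<And>c i j. c \<in> lattice_points u (CARD('d) + 1) \<Longrightarrow> i \<in> Poly_Mapping.keys c \<Longrightarrow>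
      j \<in> Poly_Mapping.keys c \<Longrightarrow> (i, j) \<in> (edge_rel X c)\<^sup>*"
  shows "scale_module.span (kappa ` tab u X) = (schur_module_le u 1 CARD('d) :: ('n, 'r::comm_ring_1) wedge_sym set)"
proof (rule subset_antisym[OF span_tab_subset], rule subsetI)
  fix x :: "('n, 'r) wedge_sym"
  let ?N = "scale_module.span (kappa ` (tab u X :: ('n, 'r) wedge_sym set))"
  assume x: "x \<in> schur_module_le u 1 CARD('d)"
  then have part: "x \<in> wedge_sym_part 1 CARD('d)" and "kappa x = 0"
    and le: "z \<in> Poly_Mapping.keys x \<Longrightarrow> Poly_Mapping.lookup (multidegree z) i \<le> u i" for z i
    by (simp_all add: schur_module_le_def schur_module_def)
  \<comment> \<open>The differences along a path telescope.\<close>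
  have diff: "Poly_Mapping.single (vertex_elt c i) 1 - Poly_Mapping.single (vertex_elt c j) 1 \<in> ?N"
    if c: "c \<in> lattice_points u (CARD('d) + 1)" and ij: "i \<in> Poly_Mapping.keys c" "j \<in> Poly_Mapping.keys c" for c i j
    using connected[OF c ij]
  proof (induction rule: rtrancl_induct)
    case base
    show ?case
      by (simp add: scale_module.span_zero)
  next
    case (step k l)
    then have "linear_syzygy_edge X c k l"
      by simp
    from scale_module.span_add[OF step.IH edge_diff_in_span_tab[OF c this]] show ?case
      by simp
  qed
  have vertex: "\<exists>c i. c \<in> lattice_points u (CARD('d) + 1) \<and> i \<in> Poly_Mapping.keys c \<and>
      z = vertex_elt c i \<and> multidegree z = c" if z: "z \<in> Poly_Mapping.keys x" for z
  proof -
    obtain J \<alpha> where J: "z = (J, \<alpha>)"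
      by (cases z)
    with z part have "card J = 1" and \<alpha>: "total_degree \<alpha> = CARD('d)"
      by (auto simp: wedge_sym_part_def)
    then obtain j where "J = {j}"
      by (rule_tac card_1_singletonE)
    then have md: "multidegree z = eps j + \<alpha>"
      by (simp add: J multidegree_def add.commute)
    have "eps j + \<alpha> \<in> lattice_points u (CARD('d) + 1)"
      using le[OF z] unfolding md by (simp add: lattice_points_def total_degree_add \<alpha>)
    moreover have "z = vertex_elt (eps j + \<alpha>) j"
      by (simp add: J \<open>J = {j}\<close>)
    ultimately show ?thesis
      using md eps_in_keys_add[of j \<alpha>] by (intro exI[of _ "eps j + \<alpha>"] exI[of _ j] conjI)
  qed
  show "x \<in> ?N"
  proof (rule in_submonoid_if_push_eq_0)
    show "push (\<lambda>z. ({} :: 'n set, multidegree z)) x = 0"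
      using \<open>kappa x = 0\<close> kappa_singleton_part[OF part] by simp
    fix s t and r :: 'r
    assume st: "s \<in> Poly_Mapping.keys x" "t \<in> Poly_Mapping.keys x"
      and "({} :: 'n set, multidegree s) = ({}, multidegree t)"
    then have "multidegree s = multidegree t"
      by simp
    with vertex[OF st(1)] vertex[OF st(2)] diff
    have "Poly_Mapping.single s 1 - Poly_Mapping.single t 1 \<in> ?N"
      by auto
    then have "scale r (Poly_Mapping.single s 1 - Poly_Mapping.single t 1) \<in> ?N"
      by (rule scale_module.span_scale)
    then show "Poly_Mapping.single s r - Poly_Mapping.single t r \<in> ?N"
      by (simp add: scale_module.scale_right_diff_distrib scale_single)
  qed (simp_all add: scale_module.span_zero scale_module.span_add)
qed

lemma connected_if_span_tab:
  fixes X :: "'n::{finite,linorder} \<Rightarrow> ('n \<Rightarrow>\<^sub>0 nat) \<Rightarrow> 'd::finite set"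
  assumes span: "scale_module.span (kappa ` tab u X) = (schur_module_le u 1 CARD('d) :: ('n, 'r::comm_ring_1) wedge_sym set)"
    and c: "c \<in> lattice_points u (CARD('d) + 1)"
    and ij: "i \<in> Poly_Mapping.keys c" "j \<in> Poly_Mapping.keys c"
  shows "(i, j) \<in> (edge_rel X c)\<^sup>*"
proof -
  define C where "C = {l \<in> Poly_Mapping.keys c. (i, l) \<in> (edge_rel X c)\<^sup>*}"
  \<comment> \<open>The coefficient sum over the component \<open>C\<close>, in multidegree
    \<open>c\<close> only. An edge has both ends in \<open>C\<close> or neither, so every tableau is
    killed.\<close>
  define \<psi> :: "('n, 'r) wedge_sym \<Rightarrow> 'r" where "\<psi> x = (\<Sum>l\<in>C. Poly_Mapping.lookup x (vertex_elt c l))" for x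
  have "finite C"
    by (simp add: C_def)
  have \<psi>_vertex: "\<psi> (Poly_Mapping.single (vertex_elt b l) 1) = (1 when b = c \<and> l \<in> C)"
    if l: "l \<in> Poly_Mapping.keys b" for b l
  proof -
    have "vertex_elt b l = vertex_elt c k \<longleftrightarrow> k = l \<and> b = c" if "k \<in> C" for k
    proof
      assume eq: "vertex_elt b l = vertex_elt c k"
      have "k \<in> Poly_Mapping.keys c"
        using that by (simp add: C_def)
      from multidegree_vertex_elt[OF this] multidegree_vertex_elt[OF l] have "b = c"
        unfolding eq by simp
      with eq show "k = l \<and> b = c"
        by simp
    qed simp
    then have "\<psi> (Poly_Mapping.single (vertex_elt b l) 1) = (\<Sum>k\<in>C. if k = l then (1 when b = c) else 0)"
      unfolding \<psi>_def lookup_single by (intro sum.cong) (auto simp: when_def)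
    with \<open>finite C\<close> show ?thesis
      by (simp add: when_def)
  qed
  have \<psi>_diff: "\<psi> (x - y) = \<psi> x - \<psi> y" for x y
    by (simp add: \<psi>_def lookup_minus sum_subtractf)
  have "scale_module.subspace {x. \<psi> x = 0}"
    by (rule scale_module.subspaceI)
      (simp_all add: \<psi>_def lookup_add lookup_scale sum.distrib flip: sum_distrib_left)
  moreover have "kappa ` tab u X \<subseteq> {x. \<psi> x = 0}"
  proof clarify
    fix x :: "('n, 'r) wedge_sym"
    assume "x \<in> tab u X"
    then obtain b k l where x: "x = Poly_Mapping.single ({k, l}, b - eps k - eps l) 1"
      and "k < l" and edge: "linear_syzygy_edge X b k l"
      unfolding tab_def by blast
    then have kl: "k \<in> Poly_Mapping.keys b" "l \<in> Poly_Mapping.keys b"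
      by (auto simp: linear_syzygy_edge_def)
    have "k \<in> C \<longleftrightarrow> l \<in> C" if "b = c"
      using kl edge linear_syzygy_edge_sym[OF edge] that
      unfolding C_def by (auto intro: rtrancl_into_rtrancl)
    then show "\<psi> (kappa x) = 0"
      unfolding x kappa_tab_element[OF kl \<open>k < l\<close>] \<psi>_diff \<psi>_vertex[OF kl(1)] \<psi>_vertex[OF kl(2)]
      by (auto simp: when_def)
  qed
  ultimately have "scale_module.span (kappa ` tab u X) \<subseteq> {x. \<psi> x = 0}"
    by (rule scale_module.span_minimal[rotated])
  then have "\<psi> (Poly_Mapping.single (vertex_elt c i) 1 - Poly_Mapping.single (vertex_elt c j) 1) = 0"
    unfolding span using vertex_diff_in_schur_module_le[OF c ij] by blast
  moreover have "i \<in> C"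
    using ij by (simp add: C_def)
  ultimately have "j \<in> C"
    unfolding \<psi>_diff \<psi>_vertex[OF ij(1)] \<psi>_vertex[OF ij(2)] by (auto simp: when_def split: if_splits)
  then show ?thesis
    by (simp add: C_def)
qed

theorem theorem7p8:
  fixes u :: "'n::{finite,linorder} \<Rightarrow> nat"
    and X :: "'n \<Rightarrow> ('n \<Rightarrow>\<^sub>0 nat) \<Rightarrow> 'd::{finite,linorder} set"
  assumes codomain: "\<And>i. X i \<in> lattice_points u CARD('d) \<rightarrow> boolean_poset_le (u i)"
    and isotone: "\<And>i. monotone_on (lattice_points u CARD('d)) (le_at i) (\<subseteq>) (X i)"
    and rank_preserving:
      "\<And>i a. a \<in> lattice_points u CARD('d) \<Longrightarrow> card (X i a) = Poly_Mapping.lookup a i"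
  shows
    "(module.span scale (kappa ` tab u X) =
        (schur_module_le u 1 CARD('d) :: ('n, ('v, 'k::field) mpoly) wedge_sym set)
      \<longleftrightarrow> (\<forall>c\<in>lattice_points u (CARD('d) + 1).
            \<exists>T\<subseteq>LS X c. spanning_tree_of (down_verts c) (down_edges c) T))
     \<and> ((\<forall>c\<in>lattice_points u (CARD('d) + 1).
            \<exists>T\<subseteq>LS X c. spanning_tree_of (down_verts c) (down_edges c) T)
      \<longleftrightarrow> polarization_of (ideal_of_maps u X :: ('n \<times> 'd, 'k) mpoly set)
            (restricted_power CARD('d) u))"
proof -
  interpret rank_preserving_maps u X "TYPE('k)"
    by unfold_locales (rule rank_preserving)
  \<comment> \<open>Connectedness on indices involves no coefficients, and so links the Schur module
    over \<open>('v, 'k) mpoly\<close> with the ideal over \<open>'k\<close>.\<close>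
  have tree: "(\<forall>c\<in>lattice_points u (CARD('d) + 1).
      \<exists>T\<subseteq>LS X c. spanning_tree_of (down_verts c) (down_edges c) T) \<longleftrightarrow>
    (\<forall>c\<in>lattice_points u (CARD('d) + 1). \<forall>i\<in>Poly_Mapping.keys c. \<forall>j\<in>Poly_Mapping.keys c.
      (i, j) \<in> (edge_rel X c)\<^sup>*)"
    by (intro ball_cong refl spanning_tree_LS_iff)
  show ?thesis
    unfolding tree
    using span_tab_if_connected[of u X] connected_if_span_tab[of u X]
      polarization_of_if_connected connected_if_polarization_of by blast
qed

end
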